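(* Let $\sigma_0\in\mathbb{R}$ and let $V\in L^1(\mathbb{R}_+)\cap L^2(\mathbb{R}_+)$ be real-valued. Let $\lambda_1\le\lambda_2\le\dots$ be the negative eigenvalues of the Schrödinger operator $-\frac{\mathrm{d}^2}{\mathrm{d}x^2}+V$ on $L^2(\mathbb{R}_+)$ with Robin boundary condition $\varphi'(0)-\sigma_0\varphi(0)=0$, and let $\varphi_j$ denote the eigenfunction to $\lambda_j$. Define recursively $$\sigma_j=\sigma_{j-1}+\frac{|\varphi_j(0)|^2}{\|\varphi_j\|^2},\qquad j=1,2,\dots$$ Then $$\sum_{j\ge1}|\lambda_j|^{\frac32}+\frac14\sum_{j\ge1}\left(\sigma_j^3-\sigma_{j-1}^3\right)\le\frac{3}{16}\int_0^\infty V(x)^2\,\mathrm{d}x+\frac34\sum_{j\ge1}|\lambda_j|\left(\sigma_j-\sigma_{j-1}\right).$$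
   Context: $\mathbb{R}_+=(0,\infty)$ and $\|\cdot\|$ is the norm of $L^2(\mathbb{R}_+)$. The operator $-\frac{\mathrm{d}^2}{\mathrm{d}x^2}+V$ with Robin boundary condition $\varphi'(0)-\sigma_0\varphi(0)=0$ is the self-adjoint operator acting as $\varphi\mapsto-\varphi''+V\varphi$ on those $\varphi\in L^2(\mathbb{R}_+)$ for which $\varphi,\varphi'$ are locally absolutely continuous on $[0,\infty)$, $-\varphi''+V\varphi\in L^2(\mathbb{R}_+)$ and $\varphi'(0)=\sigma_0\varphi(0)$. Its negative spectrum consists of (simple) discrete eigenvalues, finitely or infinitely many, enumerated in increasing order starting with the lowest one, $\lambda_1$. Each $\varphi_j$ is a nonzero eigenfunction, unique up to a scalar factor, so $|\varphi_j(0)|^2/\|\varphi_j\|^2$ is well defined. All sums run over the indices $j$ of the existing negative eigenvalues (an empty sum is $0$). All terms of the three sums are non-negative; if there are infinitely many negative eigenvalues the sums are understood as values in $[0,\infty]$ and the inequality is an inequality in $[0,\infty]$ (no finiteness of the two series involving $\sigma_j$ is asserted). *)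

theory Defs
  imports "HOL-Analysis.Analysis" "HOL-Library.Extended_Nat"
begin

text \<open>The non-overlapping intervals are a finite set of endpoint pairs; they are nondegenerate,
  so no interval can be listed twice and a set loses nothing against a finite sequence.\<close>

definition abs_cont_on_interval :: "real \<Rightarrow> real \<Rightarrow> (real \<Rightarrow> 'a::real_normed_vector) \<Rightarrow> bool" where
  "abs_cont_on_interval a b f \<longleftrightarrow>
     (\<forall>\<epsilon>>0. \<exists>\<delta>>0. \<forall>P :: (real \<times> real) set.
        finite P \<longrightarrow>
        (\<forall>(s, t)\<in>P. a \<le> s \<and> s < t \<and> t \<le> b) \<longrightarrow>
        disjoint_family_on (\<lambda>(s, t). {s<..<t}) P \<longrightarrow>
        (\<Sum>(s, t)\<in>P. t - s) < \<delta> \<longrightarrow>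
        (\<Sum>(s, t)\<in>P. norm (f t - f s)) < \<epsilon>)"

definition locally_abs_cont :: "(real \<Rightarrow> 'a::real_normed_vector) \<Rightarrow> bool" where
  "locally_abs_cont f \<longleftrightarrow> (\<forall>b>0. abs_cont_on_interval 0 b f)"

definition L2_halfline :: "(real \<Rightarrow> 'a::euclidean_space) set" where
  "L2_halfline = {f. f \<in> borel_measurable (lebesgue_on {0<..}) \<and>
                     (\<lambda>x. (norm (f x))\<^sup>2) absolutely_integrable_on {0<..}}"

definition L2_norm :: "(real \<Rightarrow> 'a::euclidean_space) \<Rightarrow> real" where
  "L2_norm f = sqrt (LINT x:{0<..}|lebesgue. (norm (f x))\<^sup>2)"

text \<open>Derivative on the half-line, one-sided at 0. Its value is arbitrary where the function is
  not differentiable.\<close>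

definition hderiv :: "(real \<Rightarrow> complex) \<Rightarrow> real \<Rightarrow> complex" where
  "hderiv f x = vector_derivative f (at x within {0..})"

text \<open>If the first derivative of \<open>\<phi>\<close> is locally absolutely continuous, its second derivative
  exists almost everywhere; the arbitrary values on the exceptional null set are irrelevant below.\<close>

definition schroedinger :: "(real \<Rightarrow> real) \<Rightarrow> (real \<Rightarrow> complex) \<Rightarrow> real \<Rightarrow> complex" where
  "schroedinger V \<phi> x = - hderiv (hderiv \<phi>) x + of_real (V x) * \<phi> x"

text \<open>Domain elements are represented by their absolutely continuous version on \<open>[0,\<infinity>)\<close>, so that
  \<open>\<phi> 0\<close> is meaningful. Since the derivative has an absolutely continuous, hence continuous, version,
  this version of \<open>\<phi>\<close> is differentiable at every point of \<open>[0,\<infinity>)\<close>, not only almost everywhere.\<close>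

definition robin_domain :: "(real \<Rightarrow> real) \<Rightarrow> real \<Rightarrow> (real \<Rightarrow> complex) set" where
  "robin_domain V \<sigma>\<^sub>0 =
     {\<phi>. \<phi> \<in> L2_halfline \<and>
          locally_abs_cont \<phi> \<and>
          (\<forall>x\<ge>0. \<phi> differentiable (at x within {0..})) \<and>
          locally_abs_cont (hderiv \<phi>) \<and>
          schroedinger V \<phi> \<in> L2_halfline \<and>
          hderiv \<phi> 0 = of_real \<sigma>\<^sub>0 * \<phi> 0}"

text \<open>The operator is self-adjoint, so only real eigenvalues need to be considered.\<close>

definition robin_eigenfunction ::
    "(real \<Rightarrow> real) \<Rightarrow> real \<Rightarrow> real \<Rightarrow> (real \<Rightarrow> complex) \<Rightarrow> bool" where
  "robin_eigenfunction V \<sigma>\<^sub>0 \<mu> \<phi> \<longleftrightarrow>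
     \<phi> \<in> robin_domain V \<sigma>\<^sub>0 \<and>
     \<not> (AE x in lebesgue_on {0<..}. \<phi> x = 0) \<and>
     (AE x in lebesgue_on {0<..}. schroedinger V \<phi> x = of_real \<mu> * \<phi> x)"

definition negative_eigenvalues :: "(real \<Rightarrow> real) \<Rightarrow> real \<Rightarrow> real set" where
  "negative_eigenvalues V \<sigma>\<^sub>0 = {\<mu>. \<mu> < 0 \<and> (\<exists>\<phi>. robin_eigenfunction V \<sigma>\<^sub>0 \<mu> \<phi>)}"

end

(* The proof is the double commutation method. Let u be a real solution of -u'' + V u = l u in L^2 with
   l = -k^2 < 0, u(0) = 1 and u'(0) = s, put G(x) = int_x^oo u^2 and q = u^2 / G. The potential
   V1 = V + 2 q' belongs again to L^2; every other eigenfunction w turns into w + (u / G) int_0^x u w,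
   which solves the equation for V1 with the same eigenvalue, the same value at 0 and the same norm,
   while the boundary parameter s becomes s + 1 / |u|^2. Moreover V^2 - V1^2 is the derivative of an
   explicit polynomial in u, u' and 1 / G, and the asymptotics u'/u -> -k, q -> 2k give

     int V^2 - int V1^2 = (16/3) k^3 + (4/3) ((s + a)^3 - s^3) - 4 k^2 a,   a = 1 / |u|^2.

   Removing finitely many eigenvalues one after the other and dropping the last integral proves the
   inequality for partial sums. The eigenvalue equation prescribes a second derivative whose value is
   arbitrary at points of non-differentiability; it has content only because absolutely continuous
   functions are differentiable almost everywhere and are the integrals of their derivatives, which
   follows from the Radon-Nikodym theorem applied to the variation function. *)

theory Submission
  imports Defs
begin

section \<open>Variation of absolutely continuous functions\<close>

text \<open>The recursion for \<sigma>_j is the successive change of the boundary parameter: the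
  transformation keeps the value at 0 and the norm, so the increment of the j-th step can be read
  off the original eigenfunction \<phi>_j. A single commutation divides by u and so requires u to
  have no zeros; dividing by G requires only a positive tail of u^2, so any eigenfunction may be
  removed, in any order. The obstacle is that V1 is controlled globally only through its square. The
  class of potentials carried through the induction is therefore "locally integrable with finite int
  V^2", and u'/u -> -k has to come from energy estimates in which the tail of V^2 is small. The
  factor 3/16 of the statement normalises (16/3) k^3 to |l|^(3/2) and turns 4/3 and 4 into 1/4 and
  3/4. Derivatives are treated as integrable densities, so that polynomials in u, u' and 1 / G can
  be differentiated although u'' exists only almost everywhere.\<close>

definition nonoverlapping :: "real \<Rightarrow> real \<Rightarrow> (real \<times> real) set \<Rightarrow> bool" where
  "nonoverlapping a b P \<longleftrightarrow> finite P \<and> (\<forall>(s, t)\<in>P. a \<le> s \<and> s < t \<and> t \<le> b) \<and>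
     disjoint_family_on (\<lambda>(s, t). {s<..<t}) P"

definition vsum :: "(real \<Rightarrow> real) \<Rightarrow> (real \<times> real) set \<Rightarrow> real" where
  "vsum f P = (\<Sum>(s, t)\<in>P. \<bar>f t - f s\<bar>)"

text \<open>On an unbounded set \<open>Sup\<close> has no usable value, which is why lower bounds
  for \<open>variation\<close> carry \<open>bounded_var\<close>.\<close>

definition variation :: "(real \<Rightarrow> real) \<Rightarrow> real \<Rightarrow> real \<Rightarrow> real" where
  "variation f a b = Sup (vsum f ` {P. nonoverlapping a b P})"

definition bounded_var :: "(real \<Rightarrow> real) \<Rightarrow> real \<Rightarrow> real \<Rightarrow> bool" where
  "bounded_var f a b \<longleftrightarrow> bdd_above (vsum f ` {P. nonoverlapping a b P})"

lemma abs_cont_on_interval_alt: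
  "abs_cont_on_interval a b f \<longleftrightarrow>
     (\<forall>\<epsilon>>0. \<exists>\<delta>>0. \<forall>P. nonoverlapping a b P \<longrightarrow> (\<Sum>(s, t)\<in>P. t - s) < \<delta> \<longrightarrow> vsum f P < \<epsilon>)"
  unfolding abs_cont_on_interval_def nonoverlapping_def vsum_def by (simp add: imp_conjL)

lemma nonoverlappingD:
  assumes "nonoverlapping a b P" "(s, t) \<in> P"
  shows "a \<le> s" "s < t" "t \<le> b"
  using assms unfolding nonoverlapping_def by auto

lemma nonoverlapping_disjoint:
  assumes "nonoverlapping a b P" "(s, t) \<in> P" "(u, v) \<in> P" "(s, t) \<noteq> (u, v)"
  shows "t \<le> u \<or> v \<le> s"
proof (rule ccontr)
  assume "\<not> ?thesis"
  then have "max s u < min t v" using nonoverlappingD[OF assms(1,2)] nonoverlappingD[OF assms(1,3)] by auto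
  then obtain z where "max s u < z" "z < min t v" using dense by blast
  then have "z \<in> {s<..<t} \<inter> {u<..<v}" by auto
  moreover have "{s<..<t} \<inter> {u<..<v} = {}"
    using assms unfolding nonoverlapping_def disjoint_family_on_def by fastforce
  ultimately show False by auto
qed

lemma nonoverlappingI:
  assumes "finite P" "\<And>s t. (s, t) \<in> P \<Longrightarrow> a \<le> s \<and> s < t \<and> t \<le> b"
    "\<And>s t u v. (s, t) \<in> P \<Longrightarrow> (u, v) \<in> P \<Longrightarrow> (s, t) \<noteq> (u, v) \<Longrightarrow> t \<le> u \<or> v \<le> s"
  shows "nonoverlapping a b P"
  unfolding nonoverlapping_def disjoint_family_on_def
proof (intro conjI ballI impI)
  show "finite P" by fact
next
  fix x assume "x \<in> P" then show "case x of (s, t) \<Rightarrow> a \<le> s \<and> s < t \<and> t \<le> b" using assms(2) by auto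
next
  fix m n assume mn: "m \<in> P" "n \<in> P" "m \<noteq> n"
  obtain s t u v where "m = (s, t)" "n = (u, v)" by (cases m; cases n)
  then show "(case m of (s, t) \<Rightarrow> {s<..<t}) \<inter> (case n of (s, t) \<Rightarrow> {s<..<t}) = {}"
    using assms(3)[of s t u v] mn by (auto simp: greaterThanLessThan_def)
qed

lemma nonoverlapping_empty [simp]: "nonoverlapping a b {}"
  by (simp add: nonoverlapping_def disjoint_family_on_def)

lemma nonoverlapping_single: "a < b \<Longrightarrow> nonoverlapping a b {(a, b)}"
  by (rule nonoverlappingI) auto

text \<open>Refinement, used to pass from the intervals of \<open>R\<close> to families inside them.
  Distinct intervals of \<open>R\<close> share at most an endpoint, so the families
  \<open>P r\<close> have no nondegenerate interval in common and the sums add up.\<close>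

lemma nonoverlapping_UN:
  assumes R: "nonoverlapping a b R" and P: "\<And>s t. (s, t) \<in> R \<Longrightarrow> nonoverlapping s t (P (s, t))"
  shows "nonoverlapping a b (\<Union>r\<in>R. P r)"
    and "(\<Sum>x\<in>(\<Union>r\<in>R. P r). h x) = (\<Sum>r\<in>R. \<Sum>x\<in>P r. h x)"
proof -
  have fin: "finite R" "\<And>r. r \<in> R \<Longrightarrow> finite (P r)"
    using R P unfolding nonoverlapping_def by auto
  have bounds: "fst r \<le> s \<and> s < t \<and> t \<le> snd r" if "r \<in> R" "(s, t) \<in> P r" for r s t
    using nonoverlappingD[OF P[of "fst r" "snd r"]] that by auto
  have sep: "t \<le> u \<or> v \<le> s" if "r \<in> R" "r' \<in> R" "r \<noteq> r'" "(s, t) \<in> P r" "(u, v) \<in> P r'" for r r' s t u v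
    using nonoverlapping_disjoint[OF R, of "fst r" "snd r" "fst r'" "snd r'"] bounds[of r s t] bounds[of r' u v] that
    by auto
  have sep': "t \<le> u \<or> v \<le> s" if "r \<in> R" "(s, t) \<in> P r" "(u, v) \<in> P r" "(s, t) \<noteq> (u, v)" for r s t u v
    using nonoverlapping_disjoint[OF P[of "fst r" "snd r"], of s t u v] that by auto
  show "nonoverlapping a b (\<Union>r\<in>R. P r)"
  proof (rule nonoverlappingI)
    show "finite (\<Union>r\<in>R. P r)" using fin by auto
  next
    fix s t assume "(s, t) \<in> (\<Union>r\<in>R. P r)"
    then obtain r where "r \<in> R" "(s, t) \<in> P r" by auto
    then show "a \<le> s \<and> s < t \<and> t \<le> b"
      using bounds[of r s t] nonoverlappingD[OF R, of "fst r" "snd r"] by auto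
  next
    fix s t u v assume "(s, t) \<in> (\<Union>r\<in>R. P r)" "(u, v) \<in> (\<Union>r\<in>R. P r)" "(s, t) \<noteq> (u, v)"
    then show "t \<le> u \<or> v \<le> s" using sep sep' by (metis UN_E)
  qed
  show "(\<Sum>x\<in>(\<Union>r\<in>R. P r). h x) = (\<Sum>r\<in>R. \<Sum>x\<in>P r. h x)"
  proof (rule sum.UNION_disjoint)
    show "\<forall>i\<in>R. \<forall>j\<in>R. i \<noteq> j \<longrightarrow> P i \<inter> P j = {}"
    proof (intro ballI impI)
      fix i j assume ij: "i \<in> R" "j \<in> R" "i \<noteq> j"
      have False if "x \<in> P i" "x \<in> P j" for x
        using sep[OF ij, of "fst x" "snd x" "fst x" "snd x"] bounds[of i "fst x" "snd x"] ij that by auto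
      then show "P i \<inter> P j = {}" by auto
    qed
  qed (use fin in auto)
qed

lemma nonoverlapping_length:
  assumes "nonoverlapping a b P" "a \<le> b"
  shows "(\<Sum>(s, t)\<in>P. t - s) \<le> b - a"
proof -
  have "(\<Sum>(s, t)\<in>P. t - s) = (\<Sum>x\<in>P. measure lborel (case x of (s, t) \<Rightarrow> {s<..<t}))"
    using assms by (intro sum.cong) (auto simp: nonoverlapping_def)
  also have "\<dots> = measure lborel (\<Union>x\<in>P. case x of (s, t) \<Rightarrow> {s<..<t})"
    by (rule measure_finite_Union[symmetric])
       (use assms in \<open>auto simp: nonoverlapping_def split: prod.splits\<close>)
  also have "\<dots> \<le> measure lborel {a..b}"
    by (rule measure_mono_fmeasurable)
       (use assms in \<open>auto simp: nonoverlapping_def fmeasurable_def split: prod.splits\<close>)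
  also have "\<dots> = b - a" using assms by simp
  finally show ?thesis .
qed

text \<open>Every interval of \<open>P\<close> is truncated at \<open>b\<close>. Only an interval
  straddling \<open>b\<close> needs the triangle inequality through \<open>f b\<close>; the others
  contribute the same term to one of the two sides.\<close>

lemma vsum_split:
  assumes P: "nonoverlapping a c P" and b: "a \<le> b" "b \<le> c"
  obtains L R where "nonoverlapping a b L" "nonoverlapping b c R" "vsum f P \<le> vsum f L + vsum f R"
proof -
  define l where "l = (\<lambda>(s::real, t). (s, min t b))"
  define r where "r = (\<lambda>(s, t::real). (max s b, t))"
  define PL where "PL = {x \<in> P. fst x < b}"
  define PR where "PR = {x \<in> P. b < snd x}"
  have fin: "finite P" using P by (simp add: nonoverlapping_def)
  note D = nonoverlappingD[OF P] and S = nonoverlapping_disjoint[OF P]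
  \<comment> \<open>Truncation on the right could merge two pairs only if they had the same left
    endpoint, and nonoverlapping intervals with this property coincide. For \<open>r\<close> the
    right endpoints play this role.\<close>
  have injl: "inj_on l PL"
  proof (rule inj_onI)
    fix x y assume xy: "x \<in> PL" "y \<in> PL" "l x = l y"
    show "x = y"
      using xy S[of "fst x" "snd x" "fst y" "snd y"] D[of "fst x" "snd x"] D[of "fst y" "snd y"]
      unfolding PL_def l_def by (cases x; cases y) (auto split: prod.splits)
  qed
  have injr: "inj_on r PR"
  proof (rule inj_onI)
    fix x y assume xy: "x \<in> PR" "y \<in> PR" "r x = r y"
    show "x = y"
      using xy S[of "fst x" "snd x" "fst y" "snd y"] D[of "fst x" "snd x"] D[of "fst y" "snd y"]
      unfolding PR_def r_def by (cases x; cases y) (auto split: prod.splits)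
  qed
  have L: "nonoverlapping a b (l ` PL)"
  proof (rule nonoverlappingI)
    show "finite (l ` PL)" using fin by (auto simp: PL_def)
  next
    fix s t assume "(s, t) \<in> l ` PL"
    then show "a \<le> s \<and> s < t \<and> t \<le> b" using D by (auto simp: PL_def l_def)
  next
    fix s t u v assume st: "(s, t) \<in> l ` PL" "(u, v) \<in> l ` PL" "(s, t) \<noteq> (u, v)"
    then obtain t' v' where "(s, t') \<in> P" "t = min t' b" "(u, v') \<in> P" "v = min v' b"
      by (auto simp: PL_def l_def)
    moreover from this have "t' \<le> u \<or> v' \<le> s" using S[of s t' u v'] st(3) by auto
    ultimately show "t \<le> u \<or> v \<le> s" by (auto simp: min_le_iff_disj)
  qed
  have R: "nonoverlapping b c (r ` PR)"
  proof (rule nonoverlappingI)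
    show "finite (r ` PR)" using fin by (auto simp: PR_def)
  next
    fix s t assume "(s, t) \<in> r ` PR"
    then show "b \<le> s \<and> s < t \<and> t \<le> c" using D by (auto simp: PR_def r_def)
  next
    fix s t u v assume st: "(s, t) \<in> r ` PR" "(u, v) \<in> r ` PR" "(s, t) \<noteq> (u, v)"
    then obtain s' u' where "(s', t) \<in> P" "s = max s' b" "(u', v) \<in> P" "u = max u' b"
      by (auto simp: PR_def r_def)
    moreover from this have "t \<le> u' \<or> v \<le> s'" using S[of s' t u' v] st(3) by auto
    ultimately show "t \<le> u \<or> v \<le> s" by (auto simp: le_max_iff_disj)
  qed
  define hl where "hl = (\<lambda>x. if fst x < b then \<bar>f (snd (l x)) - f (fst (l x))\<bar> else 0)"
  define hr where "hr = (\<lambda>x. if b < snd x then \<bar>f (snd (r x)) - f (fst (r x))\<bar> else 0)"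
  have "vsum f (l ` PL) = (\<Sum>x\<in>PL. \<bar>f (snd (l x)) - f (fst (l x))\<bar>)"
    unfolding vsum_def by (subst sum.reindex[OF injl]) (simp add: case_prod_unfold)
  also have "\<dots> = (\<Sum>x\<in>P. hl x)"
    unfolding PL_def hl_def by (subst sum.inter_filter[OF fin]) simp
  finally have 1: "vsum f (l ` PL) = (\<Sum>x\<in>P. hl x)" .
  have "vsum f (r ` PR) = (\<Sum>x\<in>PR. \<bar>f (snd (r x)) - f (fst (r x))\<bar>)"
    unfolding vsum_def by (subst sum.reindex[OF injr]) (simp add: case_prod_unfold)
  also have "\<dots> = (\<Sum>x\<in>P. hr x)"
    unfolding PR_def hr_def by (subst sum.inter_filter[OF fin]) simp
  finally have 2: "vsum f (r ` PR) = (\<Sum>x\<in>P. hr x)" .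
  have "vsum f P \<le> (\<Sum>x\<in>P. hl x + hr x)"
    unfolding vsum_def
  proof (rule sum_mono)
    fix x assume "x \<in> P"
    then show "(case x of (s, t) \<Rightarrow> \<bar>f t - f s\<bar>) \<le> hl x + hr x"
      using D[of "fst x" "snd x"] by (cases x) (auto simp: hl_def hr_def l_def r_def min_def max_def)
  qed
  also have "\<dots> = vsum f (l ` PL) + vsum f (r ` PR)" using 1 2 by (simp add: sum.distrib)
  finally show ?thesis using that[OF L R] by blast
qed

lemma bounded_var_join:
  assumes "bounded_var f a b" "bounded_var f b c" "a \<le> b" "b \<le> c"
  shows "bounded_var f a c"
proof -
  obtain B C where B: "\<And>P. nonoverlapping a b P \<Longrightarrow> vsum f P \<le> B" and C: "\<And>P. nonoverlapping b c P \<Longrightarrow> vsum f P \<le> C"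
    using assms unfolding bounded_var_def bdd_above_def by auto
  have "vsum f P \<le> B + C" if P: "nonoverlapping a c P" for P
  proof -
    obtain L R where "nonoverlapping a b L" "nonoverlapping b c R" "vsum f P \<le> vsum f L + vsum f R"
      using vsum_split[OF P assms(3,4)] .
    then show ?thesis using B[of L] C[of R] by linarith
  qed
  then show ?thesis unfolding bounded_var_def bdd_above_def by auto
qed

lemma nonoverlapping_mono:
  "nonoverlapping s t P \<Longrightarrow> a \<le> s \<Longrightarrow> t \<le> b \<Longrightarrow> nonoverlapping a b P"
  unfolding nonoverlapping_def by fastforce

lemma bounded_var_subset:
  assumes "bounded_var f a b" "a \<le> s" "t \<le> b"
  shows "bounded_var f s t"
proof -
  have "nonoverlapping a b P" if "nonoverlapping s t P" for P
    using nonoverlapping_mono[OF that assms(2,3)] .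
  then show ?thesis using assms(1) unfolding bounded_var_def bdd_above_def by auto
qed

text \<open>Absolute continuity with \<epsilon> = 1 bounds the variation on every piece shorter than
  \<delta> by 1, and pieces of length \<delta>/2 exhaust the interval after finitely many
  joins.\<close>

lemma abs_cont_bounded_var:
  assumes ac: "abs_cont_on_interval a b f" and "a \<le> b"
  shows "bounded_var f a b"
proof -
  obtain \<delta> where \<delta>: "\<delta> > 0" "\<And>P. nonoverlapping a b P \<Longrightarrow> (\<Sum>(s, t)\<in>P. t - s) < \<delta> \<Longrightarrow> vsum f P < 1"
    using ac unfolding abs_cont_on_interval_alt by (meson zero_less_one)
  have small: "bounded_var f s t" if "a \<le> s" "t \<le> b" "s \<le> t" "t - s < \<delta>" for s t
  proof -
    have "vsum f P \<le> 1" if P: "nonoverlapping s t P" for P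
    proof -
      have "nonoverlapping a b P" using nonoverlapping_mono[OF P \<open>a \<le> s\<close> \<open>t \<le> b\<close>] .
      moreover have "(\<Sum>(s, t)\<in>P. t - s) < \<delta>" using nonoverlapping_length[OF P] that \<open>s \<le> t\<close> \<open>t - s < \<delta>\<close> by simp
      ultimately show ?thesis using \<delta>(2)[of P] by simp
    qed
    then show ?thesis unfolding bounded_var_def bdd_above_def by auto
  qed
  have *: "bounded_var f a (min b (a + real n * (\<delta>/2)))" for n
  proof (induction n)
    case 0
    then show ?case using small[of a a] assms \<delta>(1) by (auto simp: min_def)
  next
    case (Suc n)
    show ?case
      by (rule bounded_var_join[OF Suc.IH small])
         (use assms \<delta>(1) in \<open>auto simp: min_def field_simps\<close>)
  qed
  obtain n :: nat where "real n > (b - a) / (\<delta>/2)" using reals_Archimedean2 by blast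
  then have "b - a < real n * (\<delta>/2)" using \<delta>(1) by (subst (asm) pos_divide_less_eq) auto
  then have "min b (a + real n * (\<delta>/2)) = b" by linarith
  with *[of n] show ?thesis by (rule subst[rotated])
qed

lemma vsum_le_variation:
  assumes "bounded_var f a b" "nonoverlapping a b P"
  shows "vsum f P \<le> variation f a b"
  unfolding variation_def by (rule cSUP_upper) (use assms in \<open>simp_all add: bounded_var_def\<close>)

lemma variation_le:
  assumes "\<And>P. nonoverlapping a b P \<Longrightarrow> vsum f P \<le> C"
  shows "variation f a b \<le> C"
  unfolding variation_def by (rule cSUP_least) (use assms in \<open>auto intro: nonoverlapping_empty\<close>)

lemma variation_nonneg: "bounded_var f a b \<Longrightarrow> 0 \<le> variation f a b"
  using vsum_le_variation[of f a b "{}"] by (simp add: vsum_def)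

lemma variation_approx:
  assumes "bounded_var f a b" "e > 0"
  obtains P where "nonoverlapping a b P" "variation f a b - e < vsum f P"
proof -
  have "\<exists>y\<in>vsum f ` {P. nonoverlapping a b P}. variation f a b - e < y"
    by (rule ccontr) (use variation_le[of a b f "variation f a b - e"] assms(2) in force)
  then show ?thesis using that by auto
qed

text \<open>The suprema over the single intervals of \<open>R\<close> are attained up to an error
  \<open>d\<close>, and the near-optimal families unite to one family to which the bound
  \<open>C\<close> applies. This yields both the superadditivity of the variation and its absolute
  continuity.\<close>

lemma sum_variation_le:
  assumes R: "nonoverlapping a b R" and bv: "bounded_var f a b"
    and C: "\<And>P. (\<And>s t. (s, t) \<in> R \<Longrightarrow> nonoverlapping s t (P (s, t))) \<Longrightarrow> vsum f (\<Union>r\<in>R. P r) \<le> C"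
  shows "(\<Sum>(s, t)\<in>R. variation f s t) \<le> C"
proof (rule field_le_epsilon)
  fix e :: real assume "e > 0"
  \<comment> \<open>The 1 in the denominator keeps \<open>d\<close> positive when \<open>R\<close>
    is empty.\<close>
  define d where "d = e / (1 + real (card R))"
  have d: "d > 0" using \<open>e > 0\<close> by (simp add: d_def)
  have "\<exists>P. nonoverlapping s t P \<and> variation f s t - d < vsum f P" if "(s, t) \<in> R" for s t
    using variation_approx[OF bounded_var_subset[OF bv] d, of s t] nonoverlappingD[OF R that] by metis
  then have "\<forall>r\<in>R. \<exists>P. nonoverlapping (fst r) (snd r) P \<and> variation f (fst r) (snd r) - d < vsum f P" by auto
  then obtain P where "\<forall>r\<in>R. nonoverlapping (fst r) (snd r) (P r) \<and> variation f (fst r) (snd r) - d < vsum f (P r)"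
    by (rule bchoice[THEN exE])
  then have P: "\<And>s t. (s, t) \<in> R \<Longrightarrow> nonoverlapping s t (P (s, t)) \<and> variation f s t - d < vsum f (P (s, t))"
    by fastforce
  have "(\<Sum>(s, t)\<in>R. variation f s t) \<le> (\<Sum>r\<in>R. vsum f (P r) + d)"
    using P by (intro sum_mono) fastforce
  also have "\<dots> = (\<Sum>r\<in>R. vsum f (P r)) + real (card R) * d" by (simp add: sum.distrib)
  also have "(\<Sum>r\<in>R. vsum f (P r)) = vsum f (\<Union>r\<in>R. P r)"
    unfolding vsum_def using P by (intro nonoverlapping_UN(2)[OF R, symmetric]) auto
  also have "\<dots> \<le> C" using P by (intro C) auto
  also have "real (card R) * d \<le> e" using \<open>e > 0\<close> by (simp add: d_def field_simps)
  finally show "(\<Sum>(s, t)\<in>R. variation f s t) \<le> C + e" by simp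
qed

lemma variation_add:
  assumes bv: "bounded_var f a c" and "a \<le> b" "b \<le> c"
  shows "variation f a c = variation f a b + variation f b c"
proof (rule antisym)
  note bv1 = bounded_var_subset[OF bv order_refl \<open>b \<le> c\<close>] and bv2 = bounded_var_subset[OF bv \<open>a \<le> b\<close> order_refl]
  show "variation f a c \<le> variation f a b + variation f b c"
  proof (rule variation_le)
    fix P assume P: "nonoverlapping a c P"
    obtain L R where "nonoverlapping a b L" "nonoverlapping b c R" "vsum f P \<le> vsum f L + vsum f R"
      using vsum_split[OF P assms(2,3)] .
    then show "vsum f P \<le> variation f a b + variation f b c"
      using vsum_le_variation[OF bv1, of L] vsum_le_variation[OF bv2, of R] by linarith
  qed
  have z: "variation f x x = 0" for x
  proof -
    have "P = {}" if "nonoverlapping x x P" for P using nonoverlappingD[OF that] by fastforce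
    then have "{P. nonoverlapping x x P} = {{}}" by auto
    then show ?thesis by (simp add: variation_def vsum_def)
  qed
  show "variation f a b + variation f b c \<le> variation f a c"
  \<comment> \<open>Families contain nondegenerate intervals only, so the two-interval family is
    available only for a < b < c.\<close>
  proof (cases "a = b \<or> b = c")
    case True then show ?thesis using z by auto
  next
    case False
    then have ab: "a < b" "b < c" using assms by auto
    have R: "nonoverlapping a c {(a, b), (b, c)}" by (rule nonoverlappingI) (use ab in auto)
    have "(\<Sum>(s, t)\<in>{(a, b), (b, c)}. variation f s t) \<le> variation f a c"
      by (rule sum_variation_le[OF R bv]) (intro vsum_le_variation[OF bv] nonoverlapping_UN(1)[OF R], auto)
    then show ?thesis using ab by auto
  qed
qed

lemma abs_le_variation:
  assumes "bounded_var f a b" "a \<le> b"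
  shows "\<bar>f b - f a\<bar> \<le> variation f a b"
proof (cases "a = b")
  case False
  then show ?thesis
    using vsum_le_variation[OF assms(1) nonoverlapping_single] assms by (auto simp: vsum_def)
qed (use variation_nonneg[OF assms(1)] in auto)

text \<open>Increments of the variation function are variations over the intervals of
  \<open>R\<close>. These are approximated by families inside the intervals, whose total length is
  still below \<delta>. The supremum makes the inequality weak, hence the \<epsilon>/2.\<close>

lemma abs_cont_variation:
  assumes ac: "abs_cont_on_interval a b f" and "a \<le> b"
  shows "abs_cont_on_interval a b (variation f a)"
  unfolding abs_cont_on_interval_alt
proof (intro allI impI)
  fix \<epsilon> :: real assume "\<epsilon> > 0"
  note bv = abs_cont_bounded_var[OF assms]
  obtain \<delta> where \<delta>: "\<delta> > 0" "\<And>P. nonoverlapping a b P \<Longrightarrow> (\<Sum>(s, t)\<in>P. t - s) < \<delta> \<Longrightarrow> vsum f P < \<epsilon>/2"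
    using ac \<open>\<epsilon> > 0\<close> unfolding abs_cont_on_interval_alt by (meson half_gt_zero)
  show "\<exists>\<delta>>0. \<forall>P. nonoverlapping a b P \<longrightarrow> (\<Sum>(s, t)\<in>P. t - s) < \<delta> \<longrightarrow> vsum (variation f a) P < \<epsilon>"
  proof (intro exI conjI allI impI)
    fix R assume R: "nonoverlapping a b R" and len: "(\<Sum>(s, t)\<in>R. t - s) < \<delta>"
    have "vsum (variation f a) R = (\<Sum>(s, t)\<in>R. variation f s t)"
      unfolding vsum_def
    proof (intro sum.cong refl, clarify)
      fix s t assume "(s, t) \<in> R"
      from nonoverlappingD[OF R this] have st: "a \<le> s" "s < t" "t \<le> b" by auto
      have "variation f a t = variation f a s + variation f s t"
        by (rule variation_add) (use st bounded_var_subset[OF bv] in auto)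
      moreover have "0 \<le> variation f s t"
        by (rule variation_nonneg) (use st bounded_var_subset[OF bv] in auto)
      ultimately show "\<bar>variation f a t - variation f a s\<bar> = variation f s t" by simp
    qed
    also have "\<dots> \<le> \<epsilon>/2"
    proof (rule sum_variation_le[OF R bv])
      fix P assume P: "\<And>s t. (s, t) \<in> R \<Longrightarrow> nonoverlapping s t (P (s, t))"
      have "(\<Sum>(s, t)\<in>(\<Union>r\<in>R. P r). t - s) = (\<Sum>r\<in>R. \<Sum>(s, t)\<in>P r. t - s)"
        by (rule nonoverlapping_UN(2)[OF R P])
      also have "\<dots> \<le> (\<Sum>(s, t)\<in>R. t - s)"
      proof (rule sum_mono, clarify)
        fix s t assume st: "(s, t) \<in> R"
        show "(\<Sum>(s, t)\<in>P (s, t). t - s) \<le> t - s"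
          using nonoverlapping_length[OF P[OF st]] nonoverlappingD[OF R st] by simp
      qed
      finally show "vsum f (\<Union>r\<in>R. P r) \<le> \<epsilon>/2"
        using \<delta>(2)[OF nonoverlapping_UN(1)[OF R P]] len by fastforce
    qed
    finally show "vsum (variation f a) R < \<epsilon>" using \<open>\<epsilon> > 0\<close> by simp
  qed (use \<delta> in auto)
qed

section \<open>Indefinite Lebesgue integrals\<close>

text \<open>A derivative in the sense of densities: \<open>g\<close> is determined up to a null set
  only and need not be the derivative of \<open>f\<close> at a given point. Only the behaviour on
  [0, \<infinity>) matters.\<close>

definition ac_deriv :: "(real \<Rightarrow> real) \<Rightarrow> (real \<Rightarrow> real) \<Rightarrow> bool" where
  "ac_deriv f g \<longleftrightarrow> (\<forall>b. g absolutely_integrable_on {0..b}) \<and> (\<forall>x\<ge>0. f x = f 0 + integral {0..x} g)"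

lemma ac_derivI:
  assumes "\<And>b. g absolutely_integrable_on {0..b}" "\<And>x. 0 \<le> x \<Longrightarrow> f x = f 0 + integral {0..x} g"
  shows "ac_deriv f g"
  using assms unfolding ac_deriv_def by blast

lemma ac_deriv_eq: "ac_deriv f g \<Longrightarrow> 0 \<le> x \<Longrightarrow> f x = f 0 + integral {0..x} g"
  unfolding ac_deriv_def by blast

lemma ac_deriv_absint:
  assumes "ac_deriv f g" "0 \<le> x"
  shows "g absolutely_integrable_on {x..y}"
  using assms unfolding ac_deriv_def by (meson absolutely_integrable_on_subinterval atLeastatMost_subset_iff order_refl)

lemma ac_deriv_integrable:
  assumes "ac_deriv f g" "0 \<le> x"
  shows "g integrable_on {x..y}"
  using ac_deriv_absint[OF assms] by (simp add: absolutely_integrable_on_def)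

lemma ac_deriv_diff:
  assumes "ac_deriv f g" "0 \<le> x" "x \<le> y"
  shows "f y - f x = integral {x..y} g"
proof -
  have "f y = f 0 + integral {0..y} g" "f x = f 0 + integral {0..x} g"
    using ac_deriv_eq[OF assms(1), of y] ac_deriv_eq[OF assms(1), of x] assms(2,3) by simp_all
  then show ?thesis
    using Henstock_Kurzweil_Integration.integral_combine[OF assms(2,3) ac_deriv_integrable[OF assms(1) order_refl]]
    by simp
qed

lemma ac_deriv_integral:
  assumes "\<And>b. g absolutely_integrable_on {0..b}"
  shows "ac_deriv (\<lambda>x. integral {0..x} g) g"
  by (rule ac_derivI[OF assms]) simp

lemma ac_deriv_continuous_on:
  assumes "ac_deriv f g"
  shows "continuous_on {0..b} f"
proof -
  have "continuous_on {0..b} (\<lambda>x. f 0 + integral {0..x} g)"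
    by (intro continuous_intros indefinite_integral_continuous_1 ac_deriv_integrable[OF assms]) simp
  then show ?thesis
  proof (rule continuous_on_eq)
    fix x assume "x \<in> {0..b}"
    then show "f 0 + integral {0..x} g = f x" using ac_deriv_eq[OF assms, of x] by simp
  qed
qed

lemma ac_deriv_continuous_on':
  assumes "ac_deriv f g" "0 \<le> a"
  shows "continuous_on {a..b} f"
  using continuous_on_subset[OF ac_deriv_continuous_on[OF assms(1), of b]] assms(2) by auto

lemma ac_deriv_C1:
  assumes d: "\<And>x. x \<ge> 0 \<Longrightarrow> (f has_real_derivative g x) (at x within {0..})"
    and c: "\<And>b. continuous_on {0..b} g"
  shows "ac_deriv f g"
proof (rule ac_derivI)
  show "g absolutely_integrable_on {0..b}" for b
    by (rule absolutely_integrable_continuous_real[OF c])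
next
  fix x :: real assume "0 \<le> x"
  then have "(g has_integral f x - f 0) {0..x}"
    by (rule fundamental_theorem_of_calculus)
       (auto simp: has_real_derivative_iff_has_vector_derivative[symmetric] intro: DERIV_subset[OF d])
  then show "f x = f 0 + integral {0..x} g" by (simp add: integral_unique)
qed

lemma ac_deriv_le:
  assumes "ac_deriv f g" "ac_deriv F h" "0 \<le> x" "x \<le> y" "\<And>t. x \<le> t \<Longrightarrow> t \<le> y \<Longrightarrow> g t \<le> h t"
  shows "f y - f x \<le> F y - F x"
  unfolding ac_deriv_diff[OF assms(1,3,4)] ac_deriv_diff[OF assms(2,3,4)]
  by (rule integral_le) (use assms in \<open>auto intro: ac_deriv_integrable\<close>)

lemma ac_deriv_abs_le:
  assumes "ac_deriv f g" "ac_deriv F h" "0 \<le> x" "x \<le> y" "\<And>t. x \<le> t \<Longrightarrow> t \<le> y \<Longrightarrow> \<bar>g t\<bar> \<le> h t"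
  shows "\<bar>f y - f x\<bar> \<le> F y - F x"
  using assms
  by (simp add: ac_deriv_diff flip: real_norm_def)
     (rule Henstock_Kurzweil_Integration.integral_norm_bound_integral, auto simp: ac_deriv_integrable)

lemma ac_deriv_nondecreasing:
  assumes "ac_deriv f g" "0 \<le> x" "x \<le> y" "\<And>t. x \<le> t \<Longrightarrow> t \<le> y \<Longrightarrow> 0 \<le> g t"
  shows "f x \<le> f y"
  using integral_nonneg[OF ac_deriv_integrable[OF assms(1,2)], of y] assms ac_deriv_diff[OF assms(1-3)] by simp

lemma ac_deriv_cong:
  assumes "ac_deriv f g" "\<And>x. 0 \<le> x \<Longrightarrow> F x = f x" "\<And>x. 0 \<le> x \<Longrightarrow> h x = g x"
  shows "ac_deriv F h"
proof (rule ac_derivI)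
  show "h absolutely_integrable_on {0..b}" for b
    using ac_deriv_absint[OF assms(1) order_refl, of b] assms(3) by (subst set_integrable_cong[of _ lebesgue _ _ h g]) auto
next
  fix x :: real assume x: "0 \<le> x"
  have "integral {0..x} h = integral {0..x} g" using assms(3) by (intro integral_cong) auto
  then show "F x = F 0 + integral {0..x} h" using assms(2)[OF x] assms(2)[of 0] ac_deriv_eq[OF assms(1) x] by simp
qed

lemma ac_deriv_const: "ac_deriv (\<lambda>x. c) (\<lambda>x. 0)"
  by (rule ac_derivI) auto

lemma ac_deriv_add:
  assumes "ac_deriv f g" "ac_deriv F h"
  shows "ac_deriv (\<lambda>x. f x + F x) (\<lambda>x. g x + h x)"
proof (rule ac_derivI)
  show "(\<lambda>x. g x + h x) absolutely_integrable_on {0..b}" for b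
    by (rule set_integral_add(1)[OF ac_deriv_absint[OF assms(1) order_refl] ac_deriv_absint[OF assms(2) order_refl]])
next
  fix x :: real assume x: "0 \<le> x"
  show "f x + F x = f 0 + F 0 + integral {0..x} (\<lambda>x. g x + h x)"
    using ac_deriv_eq[OF assms(1) x] ac_deriv_eq[OF assms(2) x]
      integral_add[OF ac_deriv_integrable[OF assms(1) order_refl, of x] ac_deriv_integrable[OF assms(2) order_refl, of x]]
    by simp
qed

lemma ac_deriv_cmult:
  assumes "ac_deriv f g"
  shows "ac_deriv (\<lambda>x. c * f x) (\<lambda>x. c * g x)"
proof (rule ac_derivI)
  show "(\<lambda>x. c * g x) absolutely_integrable_on {0..b}" for b
    by (rule set_integrable_mult_right) (use ac_deriv_absint[OF assms order_refl] in auto)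
next
  fix x :: real assume x: "0 \<le> x"
  show "c * f x = c * f 0 + integral {0..x} (\<lambda>x. c * g x)"
    using ac_deriv_eq[OF assms x] by (simp add: algebra_simps)
qed

lemma ac_deriv_minus:
  assumes "ac_deriv f g"
  shows "ac_deriv (\<lambda>x. - f x) (\<lambda>x. - g x)"
  using ac_deriv_cmult[OF assms, of "-1"] by simp

lemma ac_deriv_subtract:
  assumes "ac_deriv f g" "ac_deriv F h"
  shows "ac_deriv (\<lambda>x. f x - F x) (\<lambda>x. g x - h x)"
  using ac_deriv_add[OF assms(1) ac_deriv_minus[OF assms(2)]] by simp

section \<open>Propagation over short steps: product rule and unique continuation\<close>

lemma interval_step_induct:
  fixes a b \<delta> :: real
  assumes "a \<le> x" "x \<le> b" "\<delta> > 0" "P a"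
    and step: "\<And>x y. a \<le> x \<Longrightarrow> x \<le> y \<Longrightarrow> y \<le> b \<Longrightarrow> y - x < \<delta> \<Longrightarrow> P x \<Longrightarrow> P y"
  shows "P x"
proof -
  \<comment> \<open>Half steps are strictly shorter than \<delta>, and the \<open>min\<close> stops
    the walk at \<open>x\<close>.\<close>
  have "P (min x (a + real n * (\<delta>/2)))" for n
  proof (induction n)
    case 0
    then show ?case using assms by (simp add: min_def)
  next
    case (Suc n)
    show ?case
      by (rule step[OF _ _ _ _ Suc.IH]) (use assms(1-3) in \<open>auto simp: min_def field_simps\<close>)
  qed
  moreover obtain n :: nat where "real n > (x - a) / (\<delta>/2)" using reals_Archimedean2 by blast
  then have "x - a < real n * (\<delta>/2)" using assms(3) by (subst (asm) pos_divide_less_eq) auto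
  then have "min x (a + real n * (\<delta>/2)) = x" by linarith
  ultimately show ?thesis by metis
qed

lemma telescoping_bound:
  fixes H M :: "real \<Rightarrow> real"
  assumes "a \<le> b" "\<delta> > 0"
    and "\<And>x y. a \<le> x \<Longrightarrow> x \<le> y \<Longrightarrow> y \<le> b \<Longrightarrow> y - x < \<delta> \<Longrightarrow> \<bar>H y - H x\<bar> \<le> e * (M y - M x)"
  shows "\<bar>H b - H a\<bar> \<le> e * (M b - M a)"
proof (rule interval_step_induct[where P = "\<lambda>x. \<bar>H x - H a\<bar> \<le> e * (M x - M a)", OF assms(1) order_refl assms(2)])
  fix x y assume xy: "a \<le> x" "x \<le> y" "y \<le> b" "y - x < \<delta>" "\<bar>H x - H a\<bar> \<le> e * (M x - M a)"
  show "\<bar>H y - H a\<bar> \<le> e * (M y - M a)"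
    using assms(3)[OF xy(1-4)] xy(5) by (simp add: algebra_simps)
qed simp

lemma absint_continuous_mult:
  fixes F g :: "real \<Rightarrow> real"
  assumes "continuous_on {a..b} F" "g absolutely_integrable_on {a..b}"
  shows "(\<lambda>x. F x * g x) absolutely_integrable_on {a..b}"
proof (rule absolutely_integrable_bounded_measurable_product_real[OF _ _ _ assms(2)])
  show "F \<in> borel_measurable (lebesgue_on {a..b})"
    by (intro continuous_imp_measurable_on_sets_lebesgue assms(1) lmeasurable_interval fmeasurableD)
  show "bounded (F ` {a..b})"
    using compact_continuous_image[OF assms(1)] by (simp add: compact_imp_bounded)
qed auto

text \<open>On a short interval [x, y] the increment f y F y - f x F x = F y (f y - f x) + f x (F y
  - F x) differs from the integral of \<open>k\<close> by that of g (F y - F t) + h (f x - f t),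
  which uniform continuity bounds by \<open>e\<close> times the increment of \<open>M\<close>.
  Summing over short intervals and letting \<open>e\<close> tend to 0 gives H b = H 0.\<close>

lemma ac_deriv_mult:
  assumes f: "ac_deriv f g" and F: "ac_deriv F h"
  shows "ac_deriv (\<lambda>x. f x * F x) (\<lambda>x. g x * F x + f x * h x)"
proof -
  have ai1: "(\<lambda>x. g x * F x) absolutely_integrable_on {0..b}" for b
    using absint_continuous_mult[OF ac_deriv_continuous_on[OF F] ac_deriv_absint[OF f order_refl]]
    by (simp add: mult.commute)
  have ai2: "(\<lambda>x. f x * h x) absolutely_integrable_on {0..b}" for b
    by (rule absint_continuous_mult[OF ac_deriv_continuous_on[OF f] ac_deriv_absint[OF F order_refl]])
  define k where "k = (\<lambda>x. g x * F x + f x * h x)"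
  have ai: "k absolutely_integrable_on {0..b}" for b
    unfolding k_def by (rule set_integral_add(1)[OF ai1 ai2])
  define M where "M = (\<lambda>x. integral {0..x} (\<lambda>t. \<bar>g t\<bar> + \<bar>h t\<bar>))"
  have M: "ac_deriv M (\<lambda>t. \<bar>g t\<bar> + \<bar>h t\<bar>)"
    unfolding M_def using ac_deriv_absint[OF f order_refl] ac_deriv_absint[OF F order_refl]
    by (intro ac_deriv_integral set_integral_add(1) set_integrable_abs)
  define K where "K = (\<lambda>x. integral {0..x} k)"
  have K: "ac_deriv K k" unfolding K_def by (rule ac_deriv_integral[OF ai])
  define H where "H = (\<lambda>x. f x * F x - K x)"
  have "H b = H 0" if b: "0 \<le> b" for b
  proof -
    have small: "\<bar>H b - H 0\<bar> \<le> e * (M b - M 0)" if "e > 0" for e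
    proof -
      have "uniformly_continuous_on {0..b} f" "uniformly_continuous_on {0..b} F"
        using ac_deriv_continuous_on f F by (auto intro!: compact_uniformly_continuous)
      then obtain d1 d2 where d: "d1 > 0" "d2 > 0"
        "\<And>x y. x \<in> {0..b} \<Longrightarrow> y \<in> {0..b} \<Longrightarrow> dist y x < d1 \<Longrightarrow> dist (f y) (f x) < e"
        "\<And>x y. x \<in> {0..b} \<Longrightarrow> y \<in> {0..b} \<Longrightarrow> dist y x < d2 \<Longrightarrow> dist (F y) (F x) < e"
        unfolding uniformly_continuous_on_def using \<open>e > 0\<close> by metis
      show ?thesis
      proof (rule telescoping_bound[OF b])
        show "0 < min d1 d2" using d by simp
        fix x y assume xy: "0 \<le> x" "x \<le> y" "y \<le> b" "y - x < min d1 d2"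
        have A: "ac_deriv (\<lambda>t. F y * f t + f x * F t - K t) (\<lambda>t. F y * g t + f x * h t - k t)"
          by (intro ac_deriv_add ac_deriv_subtract ac_deriv_cmult f F K)
        have "\<bar>(F y * f y + f x * F y - K y) - (F y * f x + f x * F x - K x)\<bar> \<le> e * M y - e * M x"
        proof (rule ac_deriv_abs_le[OF A ac_deriv_cmult[OF M] xy(1,2)])
          fix t assume t: "x \<le> t" "t \<le> y"
          have "F y * g t + f x * h t - k t = g t * (F y - F t) + h t * (f x - f t)"
            unfolding k_def by (simp add: algebra_simps)
          also have "\<bar>\<dots>\<bar> \<le> \<bar>g t\<bar> * \<bar>F y - F t\<bar> + \<bar>h t\<bar> * \<bar>f x - f t\<bar>"
            by (metis abs_mult abs_triangle_ineq)
          also have "\<dots> \<le> \<bar>g t\<bar> * e + \<bar>h t\<bar> * e"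
            using d(3)[of t x] d(4)[of t y] t xy
            by (intro add_mono mult_left_mono) (auto simp: dist_real_def)
          finally show "\<bar>F y * g t + f x * h t - k t\<bar> \<le> e * (\<bar>g t\<bar> + \<bar>h t\<bar>)" by (simp add: algebra_simps)
        qed
        moreover have "(F y * f y + f x * F y - K y) - (F y * f x + f x * F x - K x) = H y - H x"
          unfolding H_def by (simp add: algebra_simps)
        ultimately show "\<bar>H y - H x\<bar> \<le> e * (M y - M x)" by (simp add: algebra_simps)
      qed
    qed
    have "M b - M 0 \<ge> 0" using ac_deriv_nondecreasing[OF M order_refl b] by simp
    have "\<bar>H b - H 0\<bar> \<le> 0"
    proof (rule field_le_epsilon)
      fix e :: real assume "e > 0"
      have "\<bar>H b - H 0\<bar> \<le> e / (1 + (M b - M 0)) * (M b - M 0)"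
        by (rule small) (use \<open>e > 0\<close> \<open>M b - M 0 \<ge> 0\<close> in auto)
      also have "\<dots> \<le> e" using \<open>e > 0\<close> \<open>M b - M 0 \<ge> 0\<close> by (simp add: field_simps)
      finally show "\<bar>H b - H 0\<bar> \<le> 0 + e" by simp
    qed
    then show ?thesis by simp
  qed
  have "ac_deriv (\<lambda>x. f x * F x) k"
  proof (rule ac_derivI[OF ai])
    fix x :: real assume "0 \<le> x"
    then show "f x * F x = f 0 * F 0 + integral {0..x} k"
      using \<open>\<And>b. 0 \<le> b \<Longrightarrow> H b = H 0\<close>[of x] unfolding H_def K_def by simp
  qed
  then show ?thesis unfolding k_def .
qed

lemma ac_deriv_power2:
  assumes "ac_deriv f g"
  shows "ac_deriv (\<lambda>x. (f x)\<^sup>2) (\<lambda>x. 2 * f x * g x)"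
  by (rule ac_deriv_cong[OF ac_deriv_mult[OF assms assms]]) (auto simp: power2_eq_square)

text \<open>The energy \<open>E\<close> satisfies |E'| \<le> (1 + |W|) E. On an interval where
  \<open>M\<close> grows by less than 1/2, a zero of \<open>E\<close> forces its maximum to be at
  most half of itself, hence 0. Such intervals lead from \<open>a\<close> to every \<open>x\<close>,
  on either side.\<close>

lemma ac_deriv_ode_unique:
  assumes u: "ac_deriv u v" and v: "ac_deriv v (\<lambda>x. W x * u x)"
    and W: "\<And>b. W absolutely_integrable_on {0..b}"
    and a: "0 \<le> a" "u a = 0" "v a = 0" and x: "0 \<le> x"
  shows "u x = 0 \<and> v x = 0"
proof -
  define E where "E = (\<lambda>x. (u x)\<^sup>2 + (v x)\<^sup>2)"
  have E: "ac_deriv E (\<lambda>x. 2 * u x * v x + 2 * v x * (W x * u x))"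
    unfolding E_def by (intro ac_deriv_add ac_deriv_power2 u v)
  define M where "M = (\<lambda>x. integral {0..x} (\<lambda>t. 1 + \<bar>W t\<bar>))"
  have M: "ac_deriv M (\<lambda>t. 1 + \<bar>W t\<bar>)"
    unfolding M_def using W by (intro ac_deriv_integral set_integral_add(1) set_integrable_abs) auto
  define b where "b = max a x"
  have b: "0 \<le> b" "a \<le> b" "x \<le> b" using a by (auto simp: b_def)
  have dE: "\<bar>2 * u t * v t + 2 * v t * (W t * u t)\<bar> \<le> E t * (1 + \<bar>W t\<bar>)" for t
  proof -
    have "2 * \<bar>u t * v t\<bar> \<le> E t"
      using sum_squares_bound[of "\<bar>u t\<bar>" "\<bar>v t\<bar>"] by (simp add: E_def abs_mult)
    moreover have "\<bar>2 * u t * v t + 2 * v t * (W t * u t)\<bar> \<le> 2 * \<bar>u t * v t\<bar> * (1 + \<bar>W t\<bar>)"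
    proof -
      have "2 * u t * v t + 2 * v t * (W t * u t) = 2 * (u t * v t) * (1 + W t)" by (simp add: algebra_simps)
      then show ?thesis by (auto simp: abs_mult intro!: mult_left_mono)
    qed
    ultimately show ?thesis by (smt (verit, best) mult_right_mono)
  qed
  have "uniformly_continuous_on {0..b} M"
    by (intro compact_uniformly_continuous ac_deriv_continuous_on[OF M]) auto
  then obtain \<delta> where \<delta>: "\<delta> > 0" "\<And>x y. x \<in> {0..b} \<Longrightarrow> y \<in> {0..b} \<Longrightarrow> dist y x < \<delta> \<Longrightarrow> dist (M y) (M x) < 1/2"
    unfolding uniformly_continuous_on_def by (metis half_gt_zero zero_less_one)
  have key: "E t = 0" if s: "0 \<le> s" "s \<le> r" "r \<le> b" "r - s < \<delta>" and z: "z \<in> {s..r}" "E z = 0" and t: "t \<in> {s..r}" for s r z t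
  proof -
    have "continuous_on {s..r} E" by (rule ac_deriv_continuous_on'[OF E s(1)])
    then obtain m where m: "m \<in> {s..r}" "\<And>t. t \<in> {s..r} \<Longrightarrow> E t \<le> E m"
      using continuous_attains_sup[of "{s..r}" E] s(2) by auto
    have nn: "E t \<ge> 0" for t by (simp add: E_def)
    have bound: "\<bar>E p2 - E p1\<bar> \<le> E m * (1/2)" if p: "s \<le> p1" "p1 \<le> p2" "p2 \<le> r" for p1 p2
    proof -
      have "\<bar>E p2 - E p1\<bar> \<le> E m * M p2 - E m * M p1"
      proof (rule ac_deriv_abs_le[OF E ac_deriv_cmult[OF M]])
        fix t assume "p1 \<le> t" "t \<le> p2"
        then have "E t * (1 + \<bar>W t\<bar>) \<le> E m * (1 + \<bar>W t\<bar>)" using m(2)[of t] p by (intro mult_right_mono) auto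
        then show "\<bar>2 * u t * v t + 2 * v t * (W t * u t)\<bar> \<le> E m * (1 + \<bar>W t\<bar>)" using dE[of t] by linarith
      qed (use p s in auto)
      also have "\<dots> = E m * (M p2 - M p1)" by (simp add: algebra_simps)
      also have "\<dots> \<le> E m * (1/2)"
      proof (rule mult_left_mono[OF _ nn])
        have "\<bar>M p2 - M p1\<bar> < 1/2" using \<delta>(2)[of p1 p2] p s by (simp add: dist_real_def)
        then show "M p2 - M p1 \<le> 1/2" by linarith
      qed
      finally show ?thesis .
    qed
    have "E m \<le> E m * (1/2)"
      using bound[of z m] bound[of m z] z m(1) nn[of m] by (cases "z \<le> m") auto
    then have "E m = 0" using nn[of m] by simp
    then show ?thesis using m(2)[OF t] nn[of t] by simp
  qed
  have Ea: "E a = 0" using a by (simp add: E_def)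
  have "E x = 0"
  proof (cases "a \<le> x")
    case True
    show ?thesis
    proof (rule interval_step_induct[where P = "\<lambda>x. E x = 0", OF True b(3) \<delta>(1) Ea])
      fix p r assume "a \<le> p" "p \<le> r" "r \<le> b" "r - p < \<delta>" "E p = 0"
      then show "E r = 0" using key[of p r p r] a by auto
    qed
  next
    case False
    \<comment> \<open>Leftward propagation is rightward propagation of the reflected function, from
      -a towards 0.\<close>
    have "E (- (- x)) = 0"
    proof (rule interval_step_induct[where P = "\<lambda>x. E (- x) = 0" and a = "-a" and b = 0, OF _ _ \<delta>(1)])
      fix p r assume "- a \<le> p" "p \<le> r" "r \<le> 0" "r - p < \<delta>" "E (- p) = 0"
      then show "E (- r) = 0" using key[of "- r" "- p" "- p" "- r"] b by auto
    qed (use False x Ea in auto)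
    then show ?thesis by simp
  qed
  then show ?thesis unfolding E_def by (simp add: sum_power2_eq_zero_iff)
qed

section \<open>Absolutely continuous functions are indefinite integrals\<close>

lemma abs_cont_on_interval_continuous:
  fixes f :: "real \<Rightarrow> real"
  assumes "abs_cont_on_interval a b f"
  shows "continuous_on {a..b} f"
  unfolding continuous_on_iff
proof (intro ballI allI impI)
  fix x e :: real assume x: "x \<in> {a..b}" and "0 < e"
  then obtain \<delta> where \<delta>: "\<delta> > 0" "\<And>P. nonoverlapping a b P \<Longrightarrow> (\<Sum>(s, t)\<in>P. t - s) < \<delta> \<Longrightarrow> vsum f P < e"
    using assms unfolding abs_cont_on_interval_alt by meson
  show "\<exists>d>0. \<forall>x'\<in>{a..b}. dist x' x < d \<longrightarrow> dist (f x') (f x) < e"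
  proof (intro exI conjI ballI impI)
    fix x' assume x': "x' \<in> {a..b}" "dist x' x < \<delta>"
    consider "x = x'" | "x < x'" | "x' < x" by linarith
    then show "dist (f x') (f x) < e"
    proof cases
      case 1 then show ?thesis using \<open>0 < e\<close> by simp
    next
      case 2
      then show ?thesis
        using \<delta>(2)[OF nonoverlapping_mono[OF nonoverlapping_single[OF 2]]] x x' by (simp add: vsum_def dist_real_def)
    next
      case 3
      then show ?thesis
        using \<delta>(2)[OF nonoverlapping_mono[OF nonoverlapping_single[OF 3]]] x x' by (simp add: vsum_def dist_real_def abs_minus_commute)
    qed
  qed (rule \<delta>)
qed

lemma abs_cont_on_interval_diff:
  fixes f g :: "real \<Rightarrow> real"
  assumes "abs_cont_on_interval a b f" "abs_cont_on_interval a b g"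
  shows "abs_cont_on_interval a b (\<lambda>x. f x - g x)"
  unfolding abs_cont_on_interval_alt
proof (intro allI impI)
  fix \<epsilon> :: real assume "\<epsilon> > 0"
  then have e2: "\<epsilon>/2 > 0" by simp
  obtain d1 where d1: "d1 > 0" "\<And>P. nonoverlapping a b P \<Longrightarrow> (\<Sum>(s, t)\<in>P. t - s) < d1 \<Longrightarrow> vsum f P < \<epsilon>/2"
    using assms(1) e2 unfolding abs_cont_on_interval_alt by blast
  obtain d2 where d2: "d2 > 0" "\<And>P. nonoverlapping a b P \<Longrightarrow> (\<Sum>(s, t)\<in>P. t - s) < d2 \<Longrightarrow> vsum g P < \<epsilon>/2"
    using assms(2) e2 unfolding abs_cont_on_interval_alt by blast
  have le: "vsum (\<lambda>x. f x - g x) P \<le> vsum f P + vsum g P" for P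
  proof -
    have "vsum (\<lambda>x. f x - g x) P \<le> (\<Sum>x\<in>P. (case x of (s, t) \<Rightarrow> \<bar>f t - f s\<bar>) + (case x of (s, t) \<Rightarrow> \<bar>g t - g s\<bar>))"
      unfolding vsum_def by (rule sum_mono) (auto split: prod.splits)
    then show ?thesis unfolding vsum_def by (simp only: sum.distrib)
  qed
  have "vsum (\<lambda>x. f x - g x) P < \<epsilon>" if "nonoverlapping a b P" "(\<Sum>(s, t)\<in>P. t - s) < min d1 d2" for P
    using d1(2)[of P] d2(2)[of P] that le[of P] by simp
  then show "\<exists>\<delta>>0. \<forall>P. nonoverlapping a b P \<longrightarrow> (\<Sum>(s, t)\<in>P. t - s) < \<delta> \<longrightarrow> vsum (\<lambda>x. f x - g x) P < \<epsilon>"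
    using d1(1) d2(1) by (intro exI[of _ "min d1 d2"]) auto
qed

text \<open>The null set is covered by countably many nonoverlapping closed intervals of total
  length below \<delta>. Absolute continuity controls the finite subfamilies, and continuity of the
  measure from below carries the bound \<epsilon> to the whole cover.\<close>

lemma interval_measure_null:
  fixes F :: "real \<Rightarrow> real"
  assumes mono: "\<And>x y. x \<le> y \<Longrightarrow> F x \<le> F y" and cont: "continuous_on UNIV F"
    and ac: "abs_cont_on_interval 0 b F" and b: "0 < b"
    and N: "N \<in> null_sets lborel" "N \<subseteq> {0..b}"
  shows "emeasure (interval_measure F) N = 0"
proof -
  let ?M = "interval_measure F"
  have Icc: "emeasure ?M {c..d} = ennreal (F d - F c)" if "c \<le> d" for c d
    using emeasure_interval_measure_Icc[of c d F] mono cont that by auto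
  have "emeasure ?M N \<le> ennreal \<epsilon>" if "\<epsilon> > 0" for \<epsilon>
  proof -
    obtain \<delta> where \<delta>: "\<delta> > 0" "\<And>P. nonoverlapping 0 b P \<Longrightarrow> (\<Sum>(s, t)\<in>P. t - s) < \<delta> \<Longrightarrow> vsum F P < \<epsilon>"
      using ac \<open>\<epsilon> > 0\<close> unfolding abs_cont_on_interval_alt by meson
    have N0: "N \<in> null_sets lebesgue" using N(1) by (rule null_sets_completionI)
    then have neg: "negligible N" by (simp add: negligible_iff_null_sets)
    obtain \<D> where D: "countable \<D>"
        "\<And>K. K \<in> \<D> \<Longrightarrow> K \<subseteq> cbox 0 b \<and> K \<noteq> {} \<and> (\<exists>c d. K = cbox c d)"
        "pairwise (\<lambda>A B. interior A \<inter> interior B = {}) \<D>"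
        "\<And>u v. cbox u v \<in> \<D> \<Longrightarrow> \<exists>n. \<forall>i \<in> Basis. v \<bullet> i - u \<bullet> i = (b \<bullet> i - 0 \<bullet> i)/2^n"
        "\<And>K. \<lbrakk>K \<in> \<D>; box 0 b \<noteq> {}\<rbrakk> \<Longrightarrow> interior K \<noteq> {}"
        "N \<subseteq> \<Union>\<D>" "\<Union>\<D> \<in> lmeasurable" "measure lebesgue (\<Union>\<D>) \<le> measure lebesgue N + \<delta>/2"
      by (rule measurable_outer_intervals_bounded[OF negligible_imp_measurable[OF neg], of 0 b "\<delta>/2"])
         (use N(2) \<delta>(1) in simp_all)
    have \<D>: "countable \<D>" "\<And>K. K \<in> \<D> \<Longrightarrow> K \<subseteq> {0..b} \<and> K \<noteq> {} \<and> (\<exists>c d. K = {c..d})"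
        "pairwise (\<lambda>A B. interior A \<inter> interior B = {}) \<D>"
        "\<And>K. K \<in> \<D> \<Longrightarrow> interior K \<noteq> {}"
        "N \<subseteq> \<Union>\<D>" "\<Union>\<D> \<in> lmeasurable" "measure lebesgue (\<Union>\<D>) \<le> measure lebesgue N + \<delta>/2"
      using D(1,3,5-8) D(2) b by simp_all
    have meas: "measure lebesgue (\<Union>\<D>) < \<delta>" using \<D>(7) negligible_imp_measure0[OF neg] \<delta>(1) by simp
    define lo hi :: "real set \<Rightarrow> real" where "lo = Inf" and "hi = Sup"
    have lh: "lo K < hi K \<and> {lo K..hi K} = K \<and> 0 \<le> lo K \<and> hi K \<le> b" if K: "K \<in> \<D>" for K
    proof -
      obtain c d where cd: "K = {c..d}" using \<D>(2)[OF K] by auto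
      have "c < d" using \<D>(4)[OF K] cd by (auto simp: interior_atLeastAtMost_real)
      moreover have "lo K = c" "hi K = d" using \<open>c < d\<close> cd by (auto simp: lo_def hi_def)
      ultimately show ?thesis using \<D>(2)[OF K] cd by auto
    qed
    have fin: "emeasure ?M (\<Union>\<D>') \<le> ennreal \<epsilon>" if D': "finite \<D>'" "\<D>' \<subseteq> \<D>" for \<D>'
    proof -
      define P where "P = (\<lambda>K. (lo K, hi K)) ` \<D>'"
      have inj: "inj_on (\<lambda>K. (lo K, hi K)) \<D>'"
      proof (rule inj_onI)
        fix K L assume KL: "K \<in> \<D>'" "L \<in> \<D>'" and eq: "(lo K, hi K) = (lo L, hi L)"
        have 1: "{lo K..hi K} = K" and 2: "{lo L..hi L} = L"
          using lh[OF subsetD[OF D'(2) KL(1)]] lh[OF subsetD[OF D'(2) KL(2)]] by blast+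
        have 3: "{lo K..hi K} = {lo L..hi L}" using eq by simp
        show "K = L" by (rule trans[OF 1[symmetric] trans[OF 3 2]])
      qed
      have P: "nonoverlapping 0 b P"
      proof (rule nonoverlappingI)
        show "finite P" using D' by (simp add: P_def)
      next
        fix s t assume "(s, t) \<in> P"
        then obtain K where "K \<in> \<D>" "s = lo K" "t = hi K" using D'(2) unfolding P_def by blast
        then show "0 \<le> s \<and> s < t \<and> t \<le> b" using lh[of K] by simp
      next
        fix s t u v assume st: "(s, t) \<in> P" "(u, v) \<in> P" "(s, t) \<noteq> (u, v)"
        then obtain K L where KL: "K \<in> \<D>" "L \<in> \<D>" "K \<noteq> L" "s = lo K" "t = hi K" "u = lo L" "v = hi L"
          using D'(2) unfolding P_def by fastforce
        have "interior K \<inter> interior L = {}" using \<D>(3) KL(1-3) unfolding pairwise_def by blast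
        moreover have "{s..t} = K" "{u..v} = L" and stuv: "s < t" "u < v" using lh[OF KL(1)] lh[OF KL(2)] KL(4-7) by simp_all
        ultimately have "interior {s..t} \<inter> interior {u..v} = {}" by simp
        then have dis: "{s<..<t} \<inter> {u<..<v} = {}" by (simp add: interior_atLeastAtMost_real)
        show "t \<le> u \<or> v \<le> s"
        proof (rule ccontr)
          assume "\<not> ?thesis"
          then have "max s u < min t v" using stuv by auto
          then obtain z where "max s u < z" "z < min t v" using dense by blast
          then show False using dis by auto
        qed
      qed
      have "(\<Sum>(s, t)\<in>P. t - s) = (\<Sum>x\<in>P. measure lebesgue (case x of (s, t) \<Rightarrow> {s<..<t}))"
        using P by (intro sum.cong) (auto simp: nonoverlapping_def)
      also have "\<dots> = measure lebesgue (\<Union>x\<in>P. case x of (s, t) \<Rightarrow> {s<..<t})"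
        by (rule measure_finite_Union[symmetric])
           (use P in \<open>auto simp: nonoverlapping_def split: prod.splits\<close>)
      also have "\<dots> \<le> measure lebesgue (\<Union>\<D>)"
      proof (rule measure_mono_fmeasurable[OF _ _ \<D>(6)])
        show "(\<Union>x\<in>P. case x of (s, t) \<Rightarrow> {s<..<t}) \<subseteq> \<Union>\<D>"
        proof
          fix z assume "z \<in> (\<Union>x\<in>P. case x of (s, t) \<Rightarrow> {s<..<t})"
          then obtain x where "x \<in> P" "z \<in> (case x of (s, t) \<Rightarrow> {s<..<t})" by blast
          then obtain K where K: "K \<in> \<D>" "z \<in> {lo K<..<hi K}" using D'(2) unfolding P_def by fastforce
          have "z \<in> {lo K..hi K}" using K(2) by simp
          also have "{lo K..hi K} = K" using lh[OF K(1)] by blast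
          finally have "z \<in> K" .
          then show "z \<in> \<Union>\<D>" using K(1) by blast
        qed
        have "open (\<Union>x\<in>P. case x of (s, t) \<Rightarrow> {s<..<t})" by (intro open_UN) (auto split: prod.splits)
        then show "(\<Union>x\<in>P. case x of (s, t) \<Rightarrow> {s<..<t}) \<in> sets lebesgue" by auto
      qed
      finally have "vsum F P < \<epsilon>" using meas \<delta>(2)[OF P] by simp
      moreover have "vsum F P = (\<Sum>K\<in>\<D>'. F (hi K) - F (lo K))"
      proof -
        have "vsum F P = (\<Sum>K\<in>\<D>'. \<bar>F (hi K) - F (lo K)\<bar>)"
          unfolding vsum_def P_def by (subst sum.reindex[OF inj]) simp
        also have "\<dots> = (\<Sum>K\<in>\<D>'. F (hi K) - F (lo K))"
        proof (rule sum.cong[OF refl])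
          fix K assume "K \<in> \<D>'"
          then have "K \<in> \<D>" using D' by blast
          then have "lo K \<le> hi K" using lh[of K] by simp
          then show "\<bar>F (hi K) - F (lo K)\<bar> = F (hi K) - F (lo K)" using mono[of "lo K" "hi K"] by simp
        qed
        finally show ?thesis .
      qed
      moreover have "emeasure ?M (\<Union>\<D>') \<le> (\<Sum>K\<in>\<D>'. emeasure ?M K)"
      proof -
        have "K \<in> sets ?M" if "K \<in> \<D>'" for K
        proof -
          have "{lo K..hi K} = K" using lh[OF subsetD[OF D'(2) that]] by blast
          moreover have "{lo K..hi K} \<in> sets ?M" by simp
          ultimately show ?thesis by simp
        qed
        then show ?thesis using emeasure_subadditive_finite[OF D'(1), of "\<lambda>K. K" ?M] by auto
      qed
      moreover have "(\<Sum>K\<in>\<D>'. emeasure ?M K) = (\<Sum>K\<in>\<D>'. ennreal (F (hi K) - F (lo K)))"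
      proof (rule sum.cong[OF refl])
        fix K assume "K \<in> \<D>'"
        then have "lo K < hi K" "{lo K..hi K} = K" using lh[OF subsetD[OF D'(2)]] by blast+
        then show "emeasure ?M K = ennreal (F (hi K) - F (lo K))" using Icc[of "lo K" "hi K"] by simp
      qed
      moreover have "\<dots> = ennreal (\<Sum>K\<in>\<D>'. F (hi K) - F (lo K))"
      proof (rule sum_ennreal)
        fix K assume "K \<in> \<D>'"
        then have "K \<in> \<D>" using D' by blast
          then have "lo K \<le> hi K" using lh[of K] by simp
        then show "0 \<le> F (hi K) - F (lo K)" using mono[of "lo K" "hi K"] by simp
      qed
      ultimately have "emeasure ?M (\<Union>\<D>') \<le> ennreal (vsum F P)" "vsum F P \<le> \<epsilon>" by simp_all
      then show ?thesis using ennreal_leI order_trans by blast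
    qed
    show ?thesis
    proof (cases "\<D> = {}")
      case True
      then show ?thesis using \<D>(5) by auto
    next
      case False
      \<comment> \<open>Initial pieces of an enumeration of the cover; the repetitions that occur
        for a finite cover are harmless.\<close>
      define A where "A = (\<lambda>n::nat. \<Union>(from_nat_into \<D> ` {..n}))"
      have sub: "from_nat_into \<D> ` {..n} \<subseteq> \<D>" for n using from_nat_into[OF False] by auto
      have inc: "incseq A" unfolding A_def incseq_def by (auto intro: order_trans)
      have un: "\<Union>\<D> = (\<Union>n. A n)"
      proof
        show "\<Union>\<D> \<subseteq> (\<Union>n. A n)"
        proof
          fix z assume "z \<in> \<Union>\<D>"
          then obtain K where "K \<in> \<D>" "z \<in> K" by auto
          then obtain n where "from_nat_into \<D> n = K" using from_nat_into_surj[OF \<D>(1)] by blast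
          then show "z \<in> (\<Union>n. A n)" using \<open>z \<in> K\<close> unfolding A_def by blast
        qed
        show "(\<Union>n. A n) \<subseteq> \<Union>\<D>" unfolding A_def using sub by blast
      qed
      have K: "K \<in> sets ?M" if "K \<in> \<D>" for K
        using \<D>(2)[OF that] by auto
      have "A n \<in> sets ?M" for n unfolding A_def using sub[of n] K by (intro sets.finite_Union) auto
      then have rA: "range A \<subseteq> sets ?M" by auto
      have "emeasure ?M N \<le> emeasure ?M (\<Union>n. A n)"
        using \<D>(5) un rA by (intro emeasure_mono) auto
      also have "\<dots> = (SUP n. emeasure ?M (A n))" by (rule SUP_emeasure_incseq[OF rA inc, symmetric])
      also have "\<dots> \<le> ennreal \<epsilon>"
        unfolding A_def by (intro SUP_least fin sub) auto
      finally show ?thesis .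
    qed
  qed
  have "emeasure ?M N \<le> 0"
  proof (rule ennreal_le_epsilon)
    fix e :: real assume "0 < e"
    then show "emeasure ?M N \<le> 0 + ennreal e" using \<open>\<And>\<epsilon>. 0 < \<epsilon> \<Longrightarrow> emeasure ?M N \<le> ennreal \<epsilon>\<close>[of e] by simp
  qed
  then show ?thesis by simp
qed

text \<open>Radon-Nikodym for the Stieltjes measure of \<open>p\<close>, for which Lebesgue null
  sets are null by \<open>interval_measure_null\<close>, applied to their pieces in
  [0, n + 1].\<close>

lemma mono_abs_cont_density:
  fixes p :: "real \<Rightarrow> real"
  assumes mono: "\<And>x y. 0 \<le> x \<Longrightarrow> x \<le> y \<Longrightarrow> p x \<le> p y" and ac: "locally_abs_cont p"
  shows "\<exists>g. ac_deriv p g"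
proof -
  \<comment> \<open>The constant extension to the left gives the negative half-line no mass.\<close>
  define F where "F = (\<lambda>x. p (max 0 x))"
  have monoF: "F x \<le> F y" if "x \<le> y" for x y unfolding F_def using mono that by (simp add: max_def)
  have "isCont F x" for x
  proof -
    have "continuous_on {0..\<bar>x\<bar> + 1} p"
      using ac unfolding locally_abs_cont_def by (intro abs_cont_on_interval_continuous) auto
    then have "continuous_on {-1 - \<bar>x\<bar>..\<bar>x\<bar> + 1} F"
      unfolding F_def by (rule continuous_on_compose2) (auto intro!: continuous_intros)
    then have "continuous_on {-1 - \<bar>x\<bar><..<\<bar>x\<bar> + 1} F" by (rule continuous_on_subset) auto
    then have "\<forall>y\<in>{-1 - \<bar>x\<bar><..<\<bar>x\<bar> + 1}. isCont F y" by (subst (asm) continuous_on_eq_continuous_at) auto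
    then show ?thesis by (rule bspec) auto
  qed
  then have contF: "continuous_on UNIV F" by (simp add: continuous_at_imp_continuous_on)
  have acF: "abs_cont_on_interval 0 b F" if "0 < b" for b
  proof -
    have "vsum F P = vsum p P" if "nonoverlapping 0 b P" for P
      unfolding vsum_def F_def using nonoverlappingD[OF that]
      by (intro sum.cong refl) (force simp: max_def)
    moreover have "abs_cont_on_interval 0 b p" using ac that unfolding locally_abs_cont_def by blast
    ultimately show ?thesis unfolding abs_cont_on_interval_alt by simp
  qed
  define M where "M = interval_measure F"
  have Icc: "emeasure M {c..d} = ennreal (F d - F c)" if "c \<le> d" for c d
    unfolding M_def using emeasure_interval_measure_Icc[of c d F] monoF contF that by auto
  have "absolutely_continuous lborel M"
    unfolding absolutely_continuous_def
  proof
    fix N :: "real set" assume N: "N \<in> null_sets lborel"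
    then have Nb: "N \<in> sets borel" by auto
    \<comment> \<open>\<open>Suc n\<close> keeps the right endpoint positive, as
      \<open>interval_measure_null\<close> requires.\<close>
    have 1: "N \<inter> {0..real (Suc n)} \<in> null_sets M" for n
    proof (rule null_setsI)
      have "N \<inter> {0..real (Suc n)} \<in> null_sets lborel" by (rule null_set_Int2) (use N in auto)
      then show "emeasure M (N \<inter> {0..real (Suc n)}) = 0"
        unfolding M_def by (intro interval_measure_null[OF monoF contF acF]) auto
      show "N \<inter> {0..real (Suc n)} \<in> sets M" unfolding M_def using Nb by auto
    qed
    have 2: "{- real n..0} \<in> null_sets M" for n
      by (rule null_setsI) (use Icc[of "- real n" 0] in \<open>auto simp: M_def F_def\<close>)
    have "(\<Union>n. N \<inter> {0..real (Suc n)}) \<union> (\<Union>n. {- real n..0}) \<in> null_sets M"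
      using 1 2 by (intro null_sets.Un null_sets_UN) auto
    moreover have "N \<subseteq> (\<Union>n. N \<inter> {0..real (Suc n)}) \<union> (\<Union>n. {- real n..0})"
    proof
      fix x assume "x \<in> N"
      obtain n where n: "\<bar>x\<bar> \<le> real n" using real_arch_simple by blast
      then show "x \<in> (\<Union>n. N \<inter> {0..real (Suc n)}) \<union> (\<Union>n. {- real n..0})"
      proof (cases "0 \<le> x")
        case True
        then have "x \<in> N \<inter> {0..real (Suc n)}" using n \<open>x \<in> N\<close> by auto
        then show ?thesis by blast
      next
        case False
        then have "x \<in> {- real n..0}" using n by auto
        then show ?thesis by blast
      qed
    qed
    ultimately show "N \<in> null_sets M"
      using Nb by (intro null_setsI) (auto simp: M_def intro: emeasure_eq_0)
  qed
  then obtain g where g: "g \<in> borel_measurable lborel" "density lborel g = M"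
    using sigma_finite_measure.Radon_Nikodym[OF sigma_finite_lborel, of M] by (auto simp: M_def)
  \<comment> \<open>The density takes values in [0, \<infinity>]. Its integral over bounded
    intervals is finite, so the value \<infinity>, which \<open>enn2real\<close> sends to 0, occurs
    on a null set only.\<close>
  define h where "h = (\<lambda>x. enn2real (g x))"
  have hi: "(h has_integral (F y - F x)) {x..y}" if "x \<le> y" for x y
  proof -
    have eq: "(\<integral>\<^sup>+ t. g t * indicator {x..y} t \<partial>lborel) = ennreal (F y - F x)"
      using emeasure_density[OF g(1), of "{x..y}"] g(2) Icc[OF that] by simp
    then have "AE t in lborel. g t * indicator {x..y} t \<noteq> \<infinity>"
      by (intro nn_integral_PInf_AE) (use g(1) in \<open>auto simp: measurable_lborel2\<close>)
    then have "AE t in lborel. g t * indicator {x..y} t = ennreal (h t * indicator {x..y} t)"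
      by eventually_elim (auto simp: h_def indicator_def ennreal_enn2real_if top_unique)
    then have "(\<integral>\<^sup>+ t. ennreal (h t * indicator {x..y} t) \<partial>lborel) = ennreal (F y - F x)"
      using nn_integral_cong_AE eq by fastforce
    then have nn: "(\<integral>\<^sup>+ t. ennreal (h t * indicator {x..y} t) \<partial>lborel) = ennreal (F y - F x)" .
    have "((\<lambda>t. h t * indicator {x..y} t) has_integral (F y - F x)) UNIV"
    proof (rule nn_integral_has_integral[OF _ _ nn])
      show "(\<lambda>t. h t * indicat_real {x..y} t) \<in> borel_measurable borel"
        unfolding h_def using g(1) by (auto simp: measurable_lborel2)
    qed (use monoF[OF that] in \<open>auto simp: h_def\<close>)
    then have "((\<lambda>t. if t \<in> {x..y} then h t else 0) has_integral (F y - F x)) UNIV"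
      by (rule has_integral_eq[rotated]) auto
    then show ?thesis by (simp only: has_integral_restrict_UNIV)
  qed
  have "ac_deriv p h"
  proof (rule ac_derivI)
    show "h absolutely_integrable_on {0..b}" for b
    proof (cases "0 \<le> b")
      case True
      show ?thesis
        by (rule nonnegative_absolutely_integrable_1) (use hi[OF True] in \<open>auto simp: h_def\<close>)
    qed auto
    show "p x = p 0 + integral {0..x} h" if "0 \<le> x" for x
      using integral_unique[OF hi[OF that]] that by (simp add: F_def)
  qed
  then show ?thesis by blast
qed

text \<open>With the variation function \<open>T\<close>, both T and T - f are nondecreasing,
  because |f y - f x| \<le> T y - T x, and absolutely continuous. The density of \<open>f\<close> is
  the difference of theirs.\<close>

theorem locally_abs_cont_imp_ac_deriv:
  fixes f :: "real \<Rightarrow> real"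
  assumes "locally_abs_cont f"
  shows "\<exists>g. ac_deriv f g"
proof -
  have ac: "abs_cont_on_interval 0 b f" if "b > 0" for b using assms that unfolding locally_abs_cont_def by blast
  define T where "T = variation f 0"
  have bv: "bounded_var f x y" if "0 \<le> x" for x y
  proof -
    have "bounded_var f 0 (max y 1)" by (rule abs_cont_bounded_var[OF ac]) auto
    then show ?thesis by (rule bounded_var_subset) (use that in auto)
  qed
  have T: "\<bar>f y - f x\<bar> \<le> T y - T x" if "0 \<le> x" "x \<le> y" for x y
    using variation_add[OF bv that] abs_le_variation[OF bv that(2)] that by (simp add: T_def)
  have acT: "locally_abs_cont T"
    unfolding locally_abs_cont_def T_def using ac by (auto intro: abs_cont_variation)
  then have acTf: "locally_abs_cont (\<lambda>x. T x - f x)"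
    using assms unfolding locally_abs_cont_def by (auto intro: abs_cont_on_interval_diff)
  obtain g where g: "ac_deriv T g"
  proof (rule mono_abs_cont_density[OF _ acT, THEN exE])
    show "T x \<le> T y" if "0 \<le> x" "x \<le> y" for x y using T[OF that] by linarith
  qed
  obtain h where h: "ac_deriv (\<lambda>x. T x - f x) h"
  proof (rule mono_abs_cont_density[OF _ acTf, THEN exE])
    show "T x - f x \<le> T y - f y" if "0 \<le> x" "x \<le> y" for x y using T[OF that] by linarith
  qed
  have "ac_deriv f (\<lambda>x. g x - h x)"
    by (rule ac_deriv_cong[OF ac_deriv_subtract[OF g h]]) auto
  then show ?thesis by blast
qed

text \<open>Lebesgue's differentiation theorem for averages over [x, x + h] gives the right
  difference quotients; applied to the reflected function it gives the left ones, with an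
  exceptional set that has to be reflected back.\<close>

lemma ac_deriv_AE_derivative:
  assumes f: "ac_deriv f g"
  obtains N where "negligible N"
    "\<And>x. 0 < x \<Longrightarrow> x \<notin> N \<Longrightarrow> (f has_real_derivative g x) (at x within {0..})"
proof -
  define G where "G = (\<lambda>t. if t \<in> {0..} then g t else 0)"
  have intG: "G integrable_on {a..b}" for a b
  proof -
    have "G integrable_on {0..\<bar>b\<bar>}"
      by (rule integrable_eq[OF ac_deriv_integrable[OF f order_refl, of "\<bar>b\<bar>"]]) (simp add: G_def)
    moreover have "G integrable_on {- \<bar>a\<bar>..0}"
      by (rule integrable_spike_finite[of "{0}" _ _ "\<lambda>_. 0"]) (auto simp: G_def)
    ultimately have "G integrable_on {- \<bar>a\<bar>..\<bar>b\<bar>}"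
      by (intro Henstock_Kurzweil_Integration.integrable_combine[of "- \<bar>a\<bar>" 0 "\<bar>b\<bar>"]) auto
    then show ?thesis by (rule integrable_on_subinterval) auto
  qed
  obtain N1 where N1: "negligible N1"
    "\<And>x e. \<lbrakk>x \<notin> N1; 0 < e\<rbrakk> \<Longrightarrow> \<exists>d>0. \<forall>h. 0 < h \<and> h < d \<longrightarrow>
        norm (integral (cbox x (x + h *\<^sub>R One)) G /\<^sub>R h ^ DIM(real) - G x) < e"
    using integrable_ccontinuous_explicit[of G] intG by (metis box_real(2))
  have intG': "(\<lambda>x. G (- x)) integrable_on {a..b}" for a b
    using intG[of "- b" "- a"] Henstock_Kurzweil_Integration.integrable_reflect_real[of G "- a" "- b"] by simp
  obtain N2 where N2: "negligible N2"
    "\<And>x e. \<lbrakk>x \<notin> N2; 0 < e\<rbrakk> \<Longrightarrow> \<exists>d>0. \<forall>h. 0 < h \<and> h < d \<longrightarrow>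
        norm (integral (cbox x (x + h *\<^sub>R One)) (\<lambda>x. G (- x)) /\<^sub>R h ^ DIM(real) - G (- x)) < e"
    using integrable_ccontinuous_explicit[of "\<lambda>x. G (- x)"] intG' by (metis box_real(2))
  have diff: "f y - f x = integral {x..y} G" if "0 \<le> x" "x \<le> y" for x y
    unfolding ac_deriv_diff[OF f that] by (rule integral_cong) (use that in \<open>auto simp: G_def\<close>)
  show ?thesis
  proof
    show "negligible (N1 \<union> uminus ` N2)"
      using N1(1) negligible_differentiable_image_negligible[OF order_refl N2(1), of uminus]
      by (auto simp: differentiable_on_def intro!: negligible_Un derivative_intros)
  next
    fix x :: real assume x: "0 < x" "x \<notin> N1 \<union> uminus ` N2"
    then have "x \<notin> N1" "- x \<notin> N2" by (auto simp: image_iff)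
    have "((\<lambda>y. (f y - f x) / (y - x)) \<longlongrightarrow> g x) (at x within {0..})"
    proof (rule tendstoI)
      fix e :: real assume "0 < e"
      obtain d1 where d1: "d1 > 0" "\<And>h. 0 < h \<Longrightarrow> h < d1 \<Longrightarrow> \<bar>integral {x..x + h} G / h - g x\<bar> < e"
        using N1(2)[OF \<open>x \<notin> N1\<close> \<open>0 < e\<close>] x by (auto simp: G_def divide_inverse mult.commute)
      obtain d2 where d2: "d2 > 0" "\<And>h. 0 < h \<Longrightarrow> h < d2 \<Longrightarrow> \<bar>integral {- x..- x + h} (\<lambda>x. G (- x)) / h - g x\<bar> < e"
        using N2(2)[OF \<open>- x \<notin> N2\<close> \<open>0 < e\<close>] x by (auto simp: G_def divide_inverse mult.commute)
      have "dist ((f y - f x) / (y - x)) (g x) < e" if y: "0 \<le> y" "y \<noteq> x" "dist y x < min d1 d2" for y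
      proof (cases "x < y")
        case True
        then show ?thesis
          using d1(2)[of "y - x"] y diff[of x y] x by (simp add: dist_real_def)
      next
        case False
        then have "y < x" using y by simp
        have "integral {- x..- y} (\<lambda>x. G (- x)) = integral {y..x} G"
          by (rule Henstock_Kurzweil_Integration.integral_reflect_real)
        then have "\<bar>(f x - f y) / (x - y) - g x\<bar> < e"
          using d2(2)[of "x - y"] y diff[of y x] \<open>y < x\<close> by (simp add: dist_real_def)
        moreover have "(f x - f y) / (x - y) = (f y - f x) / (y - x)"
          by (metis minus_diff_eq minus_divide_divide)
        ultimately show ?thesis by (simp add: dist_real_def)
      qed
      then show "eventually (\<lambda>y. dist ((f y - f x) / (y - x)) (g x) < e) (at x within {0..})"
        unfolding eventually_at using d1(1) d2(1) by (intro exI[of _ "min d1 d2"]) auto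
    qed
    then show "(f has_real_derivative g x) (at x within {0..})"
      by (simp add: has_field_derivative_iff)
  qed
qed

lemma locally_abs_cont_Re_Im:
  fixes f :: "real \<Rightarrow> complex"
  assumes "locally_abs_cont f"
  shows "locally_abs_cont (\<lambda>x. Re (f x))" "locally_abs_cont (\<lambda>x. Im (f x))"
proof -
  have main: "locally_abs_cont (\<lambda>x. h (f x))" if h: "\<And>z w. \<bar>h z - h w\<bar> \<le> cmod (z - w)" for h :: "complex \<Rightarrow> real"
    unfolding locally_abs_cont_def abs_cont_on_interval_def
  proof (intro allI impI)
    fix b \<epsilon> :: real assume "b > 0" "\<epsilon> > 0"
    then obtain \<delta> where \<delta>: "\<delta> > 0" "\<And>P. finite P \<Longrightarrow>
        (\<forall>(s, t)\<in>P. 0 \<le> s \<and> s < t \<and> t \<le> b) \<Longrightarrow>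
        disjoint_family_on (\<lambda>(s, t). {s<..<t}) P \<Longrightarrow>
        (\<Sum>(s, t)\<in>P. t - s) < \<delta> \<Longrightarrow> (\<Sum>(s, t)\<in>P. norm (f t - f s)) < \<epsilon>"
      using assms unfolding locally_abs_cont_def abs_cont_on_interval_def by blast
    have le: "(\<Sum>(s, t)\<in>P. norm (h (f t) - h (f s))) \<le> (\<Sum>(s, t)\<in>P. norm (f t - f s))" for P
      by (rule sum_mono) (use h in auto)
    show "\<exists>\<delta>>0. \<forall>P. finite P \<longrightarrow>
        (\<forall>(s, t)\<in>P. 0 \<le> s \<and> s < t \<and> t \<le> b) \<longrightarrow>
        disjoint_family_on (\<lambda>(s, t). {s<..<t}) P \<longrightarrow>
        (\<Sum>(s, t)\<in>P. t - s) < \<delta> \<longrightarrow> (\<Sum>(s, t)\<in>P. norm (h (f t) - h (f s))) < \<epsilon>"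
      using \<delta>(1) \<delta>(2)[THEN le_less_trans[OF le]] by blast
  qed
  show "locally_abs_cont (\<lambda>x. Re (f x))" by (rule main) (metis abs_Re_le_cmod minus_complex.simps(1))
  show "locally_abs_cont (\<lambda>x. Im (f x))" by (rule main) (metis abs_Im_le_cmod minus_complex.simps(2))
qed

section \<open>Decay of square-integrable solutions\<close>

text \<open>The value of the integral is part of the predicate because the identity for one removal
  step is exact in the integrals.\<close>

definition sq_lim :: "(real \<Rightarrow> real) \<Rightarrow> real \<Rightarrow> bool" where
  "sq_lim f I \<longleftrightarrow> (\<forall>b. (\<lambda>x. (f x)\<^sup>2) absolutely_integrable_on {0..b}) \<and>
     ((\<lambda>x. integral {0..x} (\<lambda>t. (f t)\<^sup>2)) \<longlongrightarrow> I) at_top"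

lemma sq_lim_ac_deriv:
  assumes "sq_lim f I"
  shows "ac_deriv (\<lambda>x. integral {0..x} (\<lambda>t. (f t)\<^sup>2)) (\<lambda>x. (f x)\<^sup>2)"
  using assms unfolding sq_lim_def by (intro ac_deriv_integral) blast

lemma ac_deriv_le_lim:
  assumes "ac_deriv f g" "ac_deriv F h" "(f \<longlongrightarrow> l) at_top" "(F \<longlongrightarrow> L) at_top"
    "0 \<le> x" "\<And>t. x \<le> t \<Longrightarrow> g t \<le> h t"
  shows "l - f x \<le> L - F x"
proof (rule tendsto_le)
  show "((\<lambda>y. F y - F x) \<longlongrightarrow> L - F x) at_top" "((\<lambda>y. f y - f x) \<longlongrightarrow> l - f x) at_top"
    by (intro tendsto_intros assms)+
  show "\<forall>\<^sub>F y in at_top. f y - f x \<le> F y - F x"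
    using eventually_ge_at_top[of x] by eventually_elim (use ac_deriv_le[OF assms(1,2,5)] assms(6) in auto)
qed simp

lemma ac_deriv_abs_le_lim:
  assumes "ac_deriv f g" "ac_deriv F h" "(f \<longlongrightarrow> l) at_top" "(F \<longlongrightarrow> L) at_top"
    "0 \<le> x" "\<And>t. x \<le> t \<Longrightarrow> \<bar>g t\<bar> \<le> h t"
  shows "\<bar>l - f x\<bar> \<le> L - F x"
proof (rule abs_leI)
  show "l - f x \<le> L - F x"
    by (rule ac_deriv_le_lim[OF assms(1-5)]) (use assms(6) in \<open>force dest: abs_le_D1\<close>)
  have "- l - - f x \<le> L - F x"
    by (rule ac_deriv_le_lim[OF ac_deriv_minus[OF assms(1)] assms(2) tendsto_minus[OF assms(3)] assms(4,5)])
       (use assms(6) in \<open>force dest: abs_le_D2\<close>)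
  then show "- (l - f x) \<le> L - F x" by simp
qed

lemma ac_deriv_id: "ac_deriv (\<lambda>x. x) (\<lambda>x. 1)"
  by (rule ac_deriv_C1) (auto intro!: derivative_eq_intros)

lemma ac_deriv_bounded_tendsto:
  assumes F: "ac_deriv F f" and nn: "\<And>x. 0 \<le> x \<Longrightarrow> 0 \<le> f x" and C: "\<And>x. 0 \<le> x \<Longrightarrow> F x \<le> C"
  shows "\<exists>L. (F \<longlongrightarrow> L) at_top"
proof
  let ?L = "SUP x\<in>{0..}. F x"
  have bdd: "bdd_above (F ` {0..})" using C unfolding bdd_above_def by auto
  have mono: "F x \<le> F y" if "0 \<le> x" "x \<le> y" for x y
    by (rule ac_deriv_nondecreasing[OF F that]) (use nn that in auto)
  show "(F \<longlongrightarrow> ?L) at_top"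
  proof (rule increasing_tendsto)
    show "\<forall>\<^sub>F x in at_top. F x \<le> ?L"
      using eventually_ge_at_top[of 0] by eventually_elim (rule cSUP_upper[OF _ bdd], simp)
  next
    fix y assume "y < ?L"
    then obtain x where x: "x \<in> {0..}" "y < F x" using less_cSUP_iff[OF _ bdd] by auto
    show "\<forall>\<^sub>F z in at_top. y < F z"
      using eventually_ge_at_top[of x] by eventually_elim (use mono[of x] x in force)
  qed
qed

lemma ac_deriv_le_limit:
  assumes F: "ac_deriv F f" and nn: "\<And>x. 0 \<le> x \<Longrightarrow> 0 \<le> f x" and L: "(F \<longlongrightarrow> L) at_top" and x: "0 \<le> x"
  shows "F x \<le> L"
  using ac_deriv_le_lim[OF ac_deriv_const F tendsto_const L x, of 0] nn x by (simp add: order_trans)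

lemma tendsto_Cauchy_at_top:
  fixes F :: "real \<Rightarrow> real"
  assumes "(F \<longlongrightarrow> L) at_top" "0 < e"
  obtains X where "X \<ge> 0" "\<And>x. X \<le> x \<Longrightarrow> \<bar>F x - L\<bar> < e"
proof -
  obtain X where X: "\<And>x. X \<le> x \<Longrightarrow> \<bar>F x - L\<bar> < e"
    using tendstoD[OF assms] unfolding eventually_at_top_linorder dist_real_def by blast
  show ?thesis by (rule that[of "max 0 X"]) (use X in auto)
qed

text \<open>\<open>F\<close> and \<open>G\<close> witness the integrability of \<open>f\<close> and
  of a bound for its derivative. Once the tail of \<open>h\<close> is below e/2, a value f x \<ge> e
  keeps \<open>f\<close> above e/2 from \<open>x\<close> on, and the integral of \<open>f\<close>
  over [x, x + 1] contradicts the convergence of \<open>F\<close>.\<close>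

lemma ac_deriv_tendsto_0:
  assumes f: "ac_deriv f g" and nn: "\<And>x. 0 \<le> x \<Longrightarrow> 0 \<le> f x"
    and F: "ac_deriv F f" "(F \<longlongrightarrow> L) at_top"
    and G: "ac_deriv G h" "(G \<longlongrightarrow> M) at_top" "\<And>x. 0 \<le> x \<Longrightarrow> \<bar>g x\<bar> \<le> h x"
  shows "(f \<longlongrightarrow> 0) at_top"
proof (rule tendstoI)
  fix e :: real assume "0 < e"
  obtain X1 where X1: "X1 \<ge> 0" "\<And>x. X1 \<le> x \<Longrightarrow> \<bar>F x - L\<bar> < e/4"
    using tendsto_Cauchy_at_top[OF F(2), of "e/4"] \<open>0 < e\<close> by auto
  obtain X2 where X2: "X2 \<ge> 0" "\<And>x. X2 \<le> x \<Longrightarrow> \<bar>G x - M\<bar> < e/4"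
    using tendsto_Cauchy_at_top[OF G(2), of "e/4"] \<open>0 < e\<close> by auto
  have small: "f x < e" if x: "x \<ge> max X1 X2" for x
  proof (rule ccontr)
    assume "\<not> f x < e"
    have lower: "e/2 \<le> f y" if "x \<le> y" for y
    proof -
      have "\<bar>f y - f x\<bar> \<le> G y - G x"
        by (rule ac_deriv_abs_le[OF f G(1)]) (use X2 x that G(3) in auto)
      moreover have "\<bar>G x - M\<bar> < e/4" "\<bar>G y - M\<bar> < e/4" using X2(2) x that by auto
      ultimately show ?thesis using \<open>\<not> f x < e\<close> by linarith
    qed
    have "e/2 * (x + 1) - e/2 * x \<le> F (x + 1) - F x"
      by (rule ac_deriv_le[OF ac_deriv_cmult[OF ac_deriv_id] F(1)]) (use X1 x lower in auto)
    moreover have "\<bar>F x - L\<bar> < e/4" "\<bar>F (x + 1) - L\<bar> < e/4" using X1(2) x by auto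
    moreover have "e/2 * (x + 1) - e/2 * x = e/2" by (simp add: algebra_simps)
    ultimately show False by linarith
  qed
  show "\<forall>\<^sub>F x in at_top. dist (f x) 0 < e"
    using eventually_ge_at_top[of "max X1 X2"]
  proof eventually_elim
    case (elim x)
    then show ?case using small[of x] nn[of x] X1(1) by simp
  qed
qed

text \<open>\<open>v\<close> stands for u', and the equation is -u'' + V u = -k^2 u. The assumptions
  on \<open>V\<close> are those that survive the removal of an eigenvalue.\<close>

locale decaying =
  fixes V u v :: "real \<Rightarrow> real" and k IV IU :: real
  assumes k: "0 < k" and V_sq_lim: "sq_lim V IV" and V_absint: "\<And>b. V absolutely_integrable_on {0..b}"
    and u: "ac_deriv u v" and v: "ac_deriv v (\<lambda>x. (V x + k\<^sup>2) * u x)"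
    and u_sq_lim: "sq_lim u IU"
begin

definition "U = (\<lambda>x. integral {0..x} (\<lambda>t. (u t)\<^sup>2))"
definition "Q = (\<lambda>x. integral {0..x} (\<lambda>t. (V t)\<^sup>2))"
definition "A = (\<lambda>x. integral {0..x} (\<lambda>t. (v t)\<^sup>2))"

lemma ac_deriv_U: "ac_deriv U (\<lambda>x. (u x)\<^sup>2)" and ac_deriv_Q: "ac_deriv Q (\<lambda>x. (V x)\<^sup>2)"
  unfolding U_def Q_def using sq_lim_ac_deriv u_sq_lim V_sq_lim by auto

lemma ac_deriv_A: "ac_deriv A (\<lambda>x. (v x)\<^sup>2)"
  unfolding A_def
  by (intro ac_deriv_integral absolutely_integrable_continuous_real continuous_intros ac_deriv_continuous_on[OF v])

lemma U_lim: "(U \<longlongrightarrow> IU) at_top" and Q_lim: "(Q \<longlongrightarrow> IV) at_top"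
  unfolding U_def Q_def using u_sq_lim V_sq_lim by (auto simp: sq_lim_def)

lemma U_le: "0 \<le> x \<Longrightarrow> U x \<le> IU" and Q_le: "0 \<le> x \<Longrightarrow> Q x \<le> IV"
  using ac_deriv_le_limit[OF ac_deriv_U _ U_lim] ac_deriv_le_limit[OF ac_deriv_Q _ Q_lim] by auto

lemma U_mono: "0 \<le> x \<Longrightarrow> x \<le> y \<Longrightarrow> U x \<le> U y" and A_mono: "0 \<le> x \<Longrightarrow> x \<le> y \<Longrightarrow> A x \<le> A y"
  and Q_mono: "0 \<le> x \<Longrightarrow> x \<le> y \<Longrightarrow> Q x \<le> Q y"
  using ac_deriv_nondecreasing[OF ac_deriv_U] ac_deriv_nondecreasing[OF ac_deriv_A] ac_deriv_nondecreasing[OF ac_deriv_Q] by auto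

lemma U_0: "U 0 = 0" and A_0: "A 0 = 0" and Q_0: "Q 0 = 0"
  unfolding U_def A_def Q_def by auto

lemma du2: "ac_deriv (\<lambda>x. (u x)\<^sup>2) (\<lambda>x. 2 * u x * v x)"
  by (rule ac_deriv_power2[OF u])

lemma duv: "ac_deriv (\<lambda>x. u x * v x) (\<lambda>x. (v x)\<^sup>2 + (V x + k\<^sup>2) * (u x)\<^sup>2)"
  by (rule ac_deriv_cong[OF ac_deriv_mult[OF u v]]) (auto simp: power2_eq_square)

lemma UA: "ac_deriv (\<lambda>x. U x + A x) (\<lambda>x. (u x)\<^sup>2 + (v x)\<^sup>2)"
  by (rule ac_deriv_add[OF ac_deriv_U ac_deriv_A])

lemma two_uv_le: "2 * u x * v x \<le> (u x)\<^sup>2 + (v x)\<^sup>2" "\<bar>2 * u x * v x\<bar> \<le> (u x)\<^sup>2 + (v x)\<^sup>2"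
proof -
  show "2 * u x * v x \<le> (u x)\<^sup>2 + (v x)\<^sup>2" by (rule sum_squares_bound)
  then show "\<bar>2 * u x * v x\<bar> \<le> (u x)\<^sup>2 + (v x)\<^sup>2"
    using sum_squares_bound[of "- u x" "v x"] by (intro abs_leI) auto
qed

text \<open>Young's inequality with weight \<eta>: the first term is paid by the tail of V^2, which
  can be made small, the second by a small multiple of u^2.\<close>

lemma Vu2_bound:
  assumes "0 < \<eta>" "(u t)\<^sup>2 \<le> K"
  shows "\<bar>V t * (u t)\<^sup>2\<bar> \<le> K / (2*\<eta>) * (V t)\<^sup>2 + \<eta>/2 * (u t)\<^sup>2"
proof -
  have "2 * (\<bar>V t\<bar> * \<eta>) \<le> (V t)\<^sup>2 + \<eta>\<^sup>2" using sum_squares_bound[of "\<bar>V t\<bar>" \<eta>] by (simp add: mult.assoc)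
  then have "\<bar>V t\<bar> \<le> (V t)\<^sup>2 / (2*\<eta>) + \<eta>/2" using assms(1) by (simp add: field_simps power2_eq_square)
  then have "\<bar>V t\<bar> * (u t)\<^sup>2 \<le> ((V t)\<^sup>2 / (2*\<eta>) + \<eta>/2) * (u t)\<^sup>2" by (rule mult_right_mono) simp
  also have "\<dots> = (V t)\<^sup>2 / (2*\<eta>) * (u t)\<^sup>2 + \<eta>/2 * (u t)\<^sup>2" by (simp add: algebra_simps)
  also have "(V t)\<^sup>2 / (2*\<eta>) * (u t)\<^sup>2 \<le> (V t)\<^sup>2 / (2*\<eta>) * K"
    using assms by (intro mult_left_mono) auto
  finally show ?thesis by (simp add: abs_mult mult.commute)
qed

text \<open>If \<open>A\<close> were unbounded, the derivative of \<open>u v\<close> would force \<open>2 u v\<close>, the derivative of \<open>u\<^sup>2\<close>, to be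
  eventually at least 2, contradicting the integrability of \<open>u\<^sup>2\<close>.\<close>

lemma A_bounded: "\<exists>C. \<forall>x\<ge>0. A x \<le> C"
proof -
  obtain X0 where X0: "X0 \<ge> 0" "\<And>x. X0 \<le> x \<Longrightarrow> \<bar>Q x - IV\<bar> < 1"
    using tendsto_Cauchy_at_top[OF Q_lim zero_less_one] by blast
  define C where "C = (u X0)\<^sup>2 / 2 + IU - u X0 * v X0"
  have main: "(A x - A X0) / 2 \<le> u x * v x + C" if x: "X0 \<le> x" for x
  proof -
    \<comment> \<open>The bound \<open>K\<close> for u^2 on [X0, x] contains A x - A X0 itself,
      since 2 u v \<le> u^2 + v^2. The tail of V^2 beyond \<open>X0\<close> is below 1, so the V^2
      term costs at most K/2 and only half of the growth of \<open>A\<close> is lost.\<close>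
    define K where "K = (u X0)\<^sup>2 + IU + (A x - A X0)"
    have K: "(u t)\<^sup>2 \<le> K" if "X0 \<le> t" "t \<le> x" for t
    proof -
      have "(u t)\<^sup>2 - (u X0)\<^sup>2 \<le> (U t + A t) - (U X0 + A X0)"
        by (rule ac_deriv_le[OF du2 UA X0(1) that(1)]) (rule two_uv_le)
      moreover have "0 \<le> U X0" "U t \<le> IU" "A t \<le> A x"
        using U_mono[of 0 X0] U_0 U_le A_mono X0(1) that by auto
      ultimately show ?thesis unfolding K_def by linarith
    qed
    have "(A x - (K/2 * Q x + 1/2 * U x)) - (A X0 - (K/2 * Q X0 + 1/2 * U X0)) \<le> u x * v x - u X0 * v X0"
    proof (rule ac_deriv_le[OF ac_deriv_subtract[OF ac_deriv_A ac_deriv_add[OF ac_deriv_cmult[OF ac_deriv_Q] ac_deriv_cmult[OF ac_deriv_U]]] duv X0(1) x])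
      fix t assume "X0 \<le> t" "t \<le> x"
      then have "\<bar>V t * (u t)\<^sup>2\<bar> \<le> K / 2 * (V t)\<^sup>2 + 1/2 * (u t)\<^sup>2" using Vu2_bound[of 1 t K] K by simp
      moreover have "0 \<le> k\<^sup>2 * (u t)\<^sup>2" by simp
      ultimately show "(v t)\<^sup>2 - (K/2 * (V t)\<^sup>2 + 1/2 * (u t)\<^sup>2) \<le> (v t)\<^sup>2 + (V t + k\<^sup>2) * (u t)\<^sup>2"
        unfolding distrib_right by linarith
    qed
    moreover have "K/2 * (Q x - Q X0) \<le> K/2 * 1"
    proof (rule mult_left_mono)
      have "\<bar>Q X0 - IV\<bar> < 1" "Q x \<le> IV" using X0 Q_le[of x] x by auto
      then show "Q x - Q X0 \<le> 1" by linarith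
      show "0 \<le> K/2" using K[OF order_refl x] zero_le_power2[of "u X0"] by linarith
    qed
    moreover have "U x - U X0 \<le> IU" using U_mono[of 0 X0] U_0 U_le[of x] X0(1) x by linarith
    ultimately have "A x - A X0 - K/2 - IU/2 \<le> u x * v x - u X0 * v X0" by (simp add: algebra_simps)
    then show ?thesis unfolding C_def K_def by (simp add: field_simps)
  qed
  \<comment> \<open>Exceeding this threshold makes \<open>main\<close> yield u v \<ge> 1 from
    \<open>x\<close> on.\<close>
  have "A x \<le> A X0 + 2 * C + 2" if x: "X0 \<le> x" for x
  proof (rule ccontr)
    assume neg: "\<not> ?thesis"
    have x0: "0 \<le> x" using X0(1) x by simp
    have big: "1 \<le> u t * v t" if "x \<le> t" for t
      using main[of t] A_mono[OF x0 that] neg x that by (simp add: field_simps)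
    have sq: "1 \<le> (u t)\<^sup>2" if "x + 1 \<le> t" for t
    proof -
      have "2 * t - 2 * x \<le> (u t)\<^sup>2 - (u x)\<^sup>2"
        by (rule ac_deriv_le[OF ac_deriv_cmult[OF ac_deriv_id] du2 x0]) (use that big in \<open>auto simp: mult.assoc\<close>)
      then show ?thesis using that zero_le_power2[of "u x"] by linarith
    qed
    \<comment> \<open>On [x + 1, y], an interval of length |IU| + 1, u^2 is at least 1, so its
      integral would exceed the limit \<open>IU\<close>.\<close>
    define y where "y = x + 1 + (\<bar>IU\<bar> + 1)"
    have "y - (x + 1) \<le> U y - U (x + 1)"
      by (rule ac_deriv_le[OF ac_deriv_id ac_deriv_U]) (use x0 sq in \<open>auto simp: y_def\<close>)
    moreover have "0 \<le> U (x + 1)" "U y \<le> IU" using U_mono[of 0 "x + 1"] U_0 U_le[of y] x0 by (auto simp: y_def)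
    ultimately show False by (simp add: y_def)
  qed
  moreover have "A x \<le> A X0" if "0 \<le> x" "x \<le> X0" for x using A_mono that by auto
  ultimately have "\<forall>x\<ge>0. A x \<le> max (A X0) (A X0 + 2 * C + 2)"
    by (metis linorder_linear max.coboundedI1 max.coboundedI2)
  then show ?thesis by blast
qed

definition "IA = (THE L. (A \<longlongrightarrow> L) at_top)"

lemma A_lim: "(A \<longlongrightarrow> IA) at_top"
proof -
  obtain L where "(A \<longlongrightarrow> L) at_top" using ac_deriv_bounded_tendsto[OF ac_deriv_A] A_bounded by auto
  moreover from this have "IA = L"
    unfolding IA_def by (intro the_equality) (auto intro: tendsto_unique[rotated])
  ultimately show ?thesis by simp
qed

lemma A_le: "0 \<le> x \<Longrightarrow> A x \<le> IA"
  using ac_deriv_le_limit[OF ac_deriv_A _ A_lim] by auto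

lemma u2_lim: "((\<lambda>x. (u x)\<^sup>2) \<longlongrightarrow> 0) at_top"
  by (rule ac_deriv_tendsto_0[OF du2 _ ac_deriv_U U_lim UA tendsto_add[OF U_lim A_lim]]) (use two_uv_le in auto)

lemma u2_le: "0 \<le> x \<Longrightarrow> (u x)\<^sup>2 \<le> (IU - U x) + (IA - A x)"
  using ac_deriv_abs_le_lim[OF du2 UA u2_lim tendsto_add[OF U_lim A_lim], of x] two_uv_le(2)
  by (force dest: abs_le_D1)

text \<open>The derivative 2 v (V + k^2) u has an integrable bound: u^2 is at most \<open>K\<close>,
  so |2 V u v| \<le> K V^2 + v^2.\<close>

lemma v2_lim: "((\<lambda>x. (v x)\<^sup>2) \<longlongrightarrow> 0) at_top"
proof -
  define K where "K = IU + IA"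
  define G where "G = (\<lambda>x. K * Q x + A x + k\<^sup>2 * (U x + A x))"
  have dG: "ac_deriv G (\<lambda>x. K * (V x)\<^sup>2 + (v x)\<^sup>2 + k\<^sup>2 * ((u x)\<^sup>2 + (v x)\<^sup>2))"
    unfolding G_def by (intro ac_deriv_add ac_deriv_cmult ac_deriv_Q ac_deriv_U ac_deriv_A)
  have Glim: "(G \<longlongrightarrow> K * IV + IA + k\<^sup>2 * (IU + IA)) at_top"
    unfolding G_def by (intro tendsto_intros Q_lim A_lim U_lim)
  show ?thesis
  proof (rule ac_deriv_tendsto_0[OF ac_deriv_power2[OF v] _ ac_deriv_A A_lim dG Glim])
    fix x :: real assume x: "0 \<le> x"
    have "(u x)\<^sup>2 \<le> K" using u2_le[OF x] U_mono[OF order_refl x] A_mono[OF order_refl x] U_0 A_0 unfolding K_def by linarith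
    then have "(V x)\<^sup>2 * (u x)\<^sup>2 \<le> K * (V x)\<^sup>2" by (subst mult.commute) (rule mult_right_mono, auto)
    moreover have "\<bar>2 * (V x * u x) * v x\<bar> \<le> (V x * u x)\<^sup>2 + (v x)\<^sup>2"
      using sum_squares_bound[of "V x * u x" "v x"] sum_squares_bound[of "- (V x * u x)" "v x"] by (intro abs_leI) auto
    moreover have "\<bar>k\<^sup>2 * (2 * u x * v x)\<bar> \<le> k\<^sup>2 * ((u x)\<^sup>2 + (v x)\<^sup>2)"
      using two_uv_le(2)[of x] by (simp add: abs_mult mult_left_mono)
    moreover have "2 * v x * ((V x + k\<^sup>2) * u x) = 2 * (V x * u x) * v x + k\<^sup>2 * (2 * u x * v x)" by (simp add: algebra_simps)
    ultimately show "\<bar>2 * v x * ((V x + k\<^sup>2) * u x)\<bar> \<le> K * (V x)\<^sup>2 + (v x)\<^sup>2 + k\<^sup>2 * ((u x)\<^sup>2 + (v x)\<^sup>2)"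
      by (simp add: power_mult_distrib)
  qed simp
qed

lemma u_lim: "(u \<longlongrightarrow> 0) at_top" and v_lim: "(v \<longlongrightarrow> 0) at_top"
  using tendsto_real_sqrt[OF u2_lim] tendsto_real_sqrt[OF v2_lim] by (auto simp: tendsto_rabs_zero_iff)

end

section \<open>Asymptotics of nontrivial decaying solutions\<close>

lemma ac_deriv_has_real_derivative:
  assumes f: "ac_deriv f g" and g: "\<And>b. continuous_on {0..b} g" and x: "0 \<le> x"
  shows "(f has_real_derivative g x) (at x within {0..})"
proof -
  have "((\<lambda>y. integral {0..y} g) has_real_derivative g x) (at x within {0..x + 1})"
    by (rule integral_has_real_derivative[OF g]) (use x in auto)
  then have "((\<lambda>y. f 0 + integral {0..y} g) has_real_derivative g x) (at x within {0..x + 1})"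
    by (auto intro!: derivative_eq_intros)
  moreover have "at x within {0..x + 1} = at x within {0..}"
    by (rule at_within_nhd[of x "{x - 1<..<x + 1}"]) (use x in auto)
  ultimately have "((\<lambda>y. f 0 + integral {0..y} g) has_real_derivative g x) (at x within {0..})" by simp
  then show ?thesis
  proof (rule has_field_derivative_transform_within[OF _ zero_less_one])
    show "f 0 + integral {0..y} g = f y" if "y \<in> {0..}" for y
      using ac_deriv_eq[OF f, of y] that by simp
  qed (use x in simp)
qed

lemma ac_deriv_power:
  assumes "ac_deriv f g"
  shows "ac_deriv (\<lambda>x. f x ^ Suc n) (\<lambda>x. real (Suc n) * f x ^ n * g x)"
proof (induction n)
  case (Suc n)
  show ?case by (rule ac_deriv_cong[OF ac_deriv_mult[OF assms Suc]]) (auto simp: algebra_simps)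
qed (use assms in simp)

lemma ac_deriv_const_eq:
  assumes "ac_deriv f (\<lambda>x. 0)" "0 \<le> x"
  shows "f x = f 0"
  using ac_deriv_eq[OF assms] by simp

text \<open>The normalisation excludes the zero solution. \<open>u\<close> may have zeros, so the
  locale covers every negative eigenvalue and not only the lowest one.\<close>

locale ground = decaying +
  assumes u_0: "u 0 = 1"
begin

text \<open>If the tail of u^2 vanished at \<open>x\<close>, then u = 0 and v would be constant
  beyond \<open>x\<close>. As v tends to 0, both vanish at \<open>x\<close>, and uniqueness for the
  equation carries this back to u 0 = 0.\<close>

lemma U_less: "0 \<le> x \<Longrightarrow> U x < IU"
proof (rule ccontr)
  assume x: "0 \<le> x" and "\<not> U x < IU"
  then have U_eq: "U y = U x" if "x \<le> y" for y
    using U_le[of y] U_mono[of x y] that by linarith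
  have u0: "u y = 0" if "x \<le> y" for y
  proof -
    have "integral {x..y + 1} (\<lambda>t. (u t)\<^sup>2) = 0"
      using ac_deriv_diff[OF ac_deriv_U x, of "y + 1"] U_eq[of "y + 1"] that by simp
    then have "\<forall>t\<in>{x..y + 1}. (u t)\<^sup>2 = 0"
      by (subst (asm) integral_eq_0_iff)
         (use x that in \<open>auto intro!: continuous_intros ac_deriv_continuous_on'[OF u]\<close>)
    then show ?thesis using that by auto
  qed
  have veq: "v y = v x" if "x \<le> y" for y
  proof -
    have "v y - v x = integral {x..y} (\<lambda>t. (V t + k\<^sup>2) * u t)" by (rule ac_deriv_diff[OF v x that])
    also have "\<dots> = integral {x..y} (\<lambda>t. 0)" by (rule integral_cong) (use u0 in auto)
    finally show ?thesis by simp
  qed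
  have "\<forall>\<^sub>F y in at_top. v y = v x"
    using eventually_ge_at_top[of x] by eventually_elim (rule veq)
  then have "((\<lambda>y::real. v x) \<longlongrightarrow> 0) at_top"
    by (rule Lim_transform_eventually[of v 0 at_top "\<lambda>_. v x", OF v_lim])
  then have "v x = 0" by (simp add: tendsto_const_iff)
  then have "u 0 = 0"
    using ac_deriv_ode_unique[OF u v set_integral_add(1)[OF V_absint] x u0[OF order_refl], of 0] by auto
  then show False using u_0 by simp
qed

text \<open>For large \<open>x\<close> the tail of \<open>V\<^sup>2\<close> is small. Integrating the derivative of \<open>u v\<close> over \<open>[x, \<infinity>)\<close> bounds
  \<open>- u v\<close> from below by the tails \<open>S\<close> of \<open>u\<^sup>2 + v\<^sup>2\<close>, while integrating that of \<open>v\<^sup>2 - k\<^sup>2 u\<^sup>2\<close>, which is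
  \<open>2 V u v\<close>, bounds \<open>\<bar>v\<^sup>2 - k\<^sup>2 u\<^sup>2\<bar>\<close> by a small multiple of \<open>S\<close>.\<close>

lemma ratio_eventually:
  assumes e: "0 < e"
  obtains X where "0 \<le> X" "\<And>x. X \<le> x \<Longrightarrow> u x \<noteq> 0 \<and> \<bar>v x / u x + k\<bar> \<le> e"
proof -
  \<comment> \<open>Chosen so that 2 m S \<le> a + k^2 G for the tails \<open>G\<close> of u^2 and
    \<open>a\<close> of v^2, with S = G + a.\<close>
  define m where "m = min 1 (k\<^sup>2) / 2"
  have m: "0 < m" "2 * m \<le> 1" "2 * m \<le> k\<^sup>2" using k by (auto simp: m_def)
  \<comment> \<open>With the tail of V^2 below \<eta>^2 and weight \<eta>, all errors are multiples
    of \<eta> S. The condition \<eta> \<le> m keeps half of 2 m S in the lower bound for - u v, and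
    2 \<eta> \<le> e m makes |v^2 - k^2 u^2| at most \<open>e\<close> times that bound.\<close>
  define \<eta> where "\<eta> = min m (e * m / 2)"
  have \<eta>: "0 < \<eta>" "\<eta> \<le> m" "2 * \<eta> \<le> e * m" using m e by (auto simp: \<eta>_def min_def)
  obtain X where X: "0 \<le> X" "\<And>x. X \<le> x \<Longrightarrow> \<bar>Q x - IV\<bar> < \<eta>\<^sup>2"
    using tendsto_Cauchy_at_top[OF Q_lim, of "\<eta>\<^sup>2"] \<eta>(1) by auto
  show ?thesis
  proof (rule that[OF X(1)])
    fix x assume "X \<le> x"
    then have x: "0 \<le> x" "IV - Q x \<le> \<eta>\<^sup>2" using X(1) X(2)[of x] by (auto simp: abs_less_iff)
    define G where "G = IU - U x"
    define a where "a = IA - A x"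
    define S where "S = G + a"
    have pos: "0 < G" "0 \<le> a" "0 < S" using U_less[OF x(1)] A_le[OF x(1)] by (auto simp: G_def a_def S_def)
    have u2S: "(u t)\<^sup>2 \<le> S" if "x \<le> t" for t
      using u2_le[of t] U_mono[OF x(1) that] A_mono[OF x(1) that] x(1) that
      unfolding S_def G_def a_def by linarith
    have QS: "S / \<eta> * (IV - Q x) \<le> S * \<eta>"
    proof -
      have "S / \<eta> * (IV - Q x) \<le> S / \<eta> * \<eta>\<^sup>2" by (rule mult_left_mono) (use x pos \<eta> in auto)
      then show ?thesis using \<eta>(1) by (simp add: power2_eq_square)
    qed
    have uv: "m * S \<le> - (u x * v x)"
    proof -
      let ?f = "\<lambda>x. A x + k\<^sup>2 * U x - (S / (2 * \<eta>) * Q x + \<eta> / 2 * U x)"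
      have "(IA + k\<^sup>2 * IU - (S / (2 * \<eta>) * IV + \<eta> / 2 * IU)) - ?f x \<le> 0 * 0 - u x * v x"
      proof (rule ac_deriv_le_lim[of ?f "\<lambda>t. (v t)\<^sup>2 + k\<^sup>2 * (u t)\<^sup>2 - (S / (2 * \<eta>) * (V t)\<^sup>2 + \<eta> / 2 * (u t)\<^sup>2)"])
        show "ac_deriv ?f (\<lambda>t. (v t)\<^sup>2 + k\<^sup>2 * (u t)\<^sup>2 - (S / (2 * \<eta>) * (V t)\<^sup>2 + \<eta> / 2 * (u t)\<^sup>2))"
          by (intro ac_deriv_add ac_deriv_subtract ac_deriv_cmult ac_deriv_A ac_deriv_U ac_deriv_Q)
        show "(?f \<longlongrightarrow> IA + k\<^sup>2 * IU - (S / (2 * \<eta>) * IV + \<eta> / 2 * IU)) at_top"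
          by (intro tendsto_intros A_lim U_lim Q_lim)
        show "((\<lambda>x. u x * v x) \<longlongrightarrow> 0 * 0) at_top" by (intro tendsto_intros u_lim v_lim)
        fix t assume "x \<le> t"
        then have "\<bar>V t * (u t)\<^sup>2\<bar> \<le> S / (2*\<eta>) * (V t)\<^sup>2 + \<eta>/2 * (u t)\<^sup>2" using Vu2_bound[OF \<eta>(1) u2S] by blast
        then show "(v t)\<^sup>2 + k\<^sup>2 * (u t)\<^sup>2 - (S / (2 * \<eta>) * (V t)\<^sup>2 + \<eta> / 2 * (u t)\<^sup>2) \<le> (v t)\<^sup>2 + (V t + k\<^sup>2) * (u t)\<^sup>2"
          unfolding distrib_right by linarith
      qed (use duv x in auto)
      then have 1: "a + k\<^sup>2 * G - S / (2 * \<eta>) * (IV - Q x) - \<eta> / 2 * G \<le> - (u x * v x)"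
        unfolding a_def G_def right_diff_distrib by linarith
      have 2: "\<eta> / 2 * G \<le> m / 2 * S" using \<eta> pos by (intro mult_mono) (auto simp: S_def)
      have 3: "S / (2 * \<eta>) * (IV - Q x) \<le> m / 2 * S"
      proof -
        have "S * \<eta> \<le> m * S" using \<eta>(2) pos by (simp add: mult.commute mult_right_mono)
        then have "S / \<eta> * (IV - Q x) \<le> m * S" using QS by (rule order_trans[rotated])
        then show ?thesis by simp
      qed
      have "2 * m * a \<le> 1 * a" "2 * m * G \<le> k\<^sup>2 * G" by (rule mult_right_mono; use m pos in simp)+
      then have "2 * m * a + 2 * m * G \<le> 1 * a + k\<^sup>2 * G" by (rule add_mono)
      then have 4: "2 * (m * S) \<le> a + k\<^sup>2 * G" by (simp add: S_def algebra_simps)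
      have "y \<le> w" if "r - p1 - p2 \<le> w" "p1 \<le> y / 2" "p2 \<le> y / 2" "2 * y \<le> r" for r p1 p2 y w :: real
        using that by linarith
      from this[OF 1 _ _ 4] 2 3 show ?thesis by simp
    qed
    have diff: "\<bar>(v x)\<^sup>2 - k\<^sup>2 * (u x)\<^sup>2\<bar> \<le> 2 * \<eta> * S"
    proof -
      have d1: "ac_deriv (\<lambda>t. (v t)\<^sup>2 - k\<^sup>2 * (u t)\<^sup>2) (\<lambda>t. 2 * v t * ((V t + k\<^sup>2) * u t) - k\<^sup>2 * (2 * u t * v t))"
        by (intro ac_deriv_subtract ac_deriv_cmult ac_deriv_power2 u v)
      have d2: "ac_deriv (\<lambda>t. S / \<eta> * Q t + \<eta> * A t) (\<lambda>t. S / \<eta> * (V t)\<^sup>2 + \<eta> * (v t)\<^sup>2)"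
        by (intro ac_deriv_add ac_deriv_cmult ac_deriv_A ac_deriv_Q)
      have "\<bar>(0 - k\<^sup>2 * 0) - ((v x)\<^sup>2 - k\<^sup>2 * (u x)\<^sup>2)\<bar> \<le> (S / \<eta> * IV + \<eta> * IA) - (S / \<eta> * Q x + \<eta> * A x)"
      proof (rule ac_deriv_abs_le_lim[OF d1 d2 _ _ x(1)])
        show "((\<lambda>t. (v t)\<^sup>2 - k\<^sup>2 * (u t)\<^sup>2) \<longlongrightarrow> 0 - k\<^sup>2 * 0) at_top" by (intro tendsto_intros v2_lim u2_lim)
        show "((\<lambda>t. S / \<eta> * Q t + \<eta> * A t) \<longlongrightarrow> S / \<eta> * IV + \<eta> * IA) at_top" by (intro tendsto_intros Q_lim A_lim)
        fix t assume t: "x \<le> t"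
        have "2 * \<bar>V t * u t\<bar> * (\<eta> * \<bar>v t\<bar>) \<le> (V t * u t)\<^sup>2 + (\<eta> * v t)\<^sup>2"
          using sum_squares_bound[of "\<bar>V t * u t\<bar>" "\<eta> * \<bar>v t\<bar>"] by (simp add: power_mult_distrib)
        also have "\<dots> \<le> (V t)\<^sup>2 * S + \<eta>\<^sup>2 * (v t)\<^sup>2"
          using u2S[OF t] by (simp add: power_mult_distrib mult_left_mono)
        finally have "2 * \<bar>V t * u t\<bar> * \<bar>v t\<bar> \<le> S / \<eta> * (V t)\<^sup>2 + \<eta> * (v t)\<^sup>2"
          using \<eta>(1) by (simp add: field_simps power2_eq_square)
        moreover have "2 * v t * ((V t + k\<^sup>2) * u t) - k\<^sup>2 * (2 * u t * v t) = 2 * (V t * u t) * v t" by (simp add: algebra_simps)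
        ultimately show "\<bar>2 * v t * ((V t + k\<^sup>2) * u t) - k\<^sup>2 * (2 * u t * v t)\<bar> \<le> S / \<eta> * (V t)\<^sup>2 + \<eta> * (v t)\<^sup>2"
          by (simp add: abs_mult)
      qed
      also have "\<dots> = S / \<eta> * (IV - Q x) + \<eta> * a" by (simp add: a_def algebra_simps)
      also have "\<dots> \<le> S * \<eta> + \<eta> * S" using QS \<eta>(1) pos by (intro add_mono mult_left_mono) (auto simp: S_def)
      finally show ?thesis by (simp add: abs_minus_commute algebra_simps)
    qed
    have uvneg: "u x * v x < 0" using uv mult_pos_pos[OF m(1) pos(3)] by linarith
    then have u_ne: "u x \<noteq> 0" by auto
    \<comment> \<open>Division by u^2 turns the estimates into |F^2 - k^2| \<le> - e F with F < 0.
      Since - F \<le> k - F and |F^2 - k^2| = |F + k| (k - F), the positive factor k - F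
      cancels.\<close>
    define F where "F = v x / u x"
    have vF: "v x = F * u x" using u_ne by (simp add: F_def)
    have "F * (u x)\<^sup>2 < 0" using uvneg unfolding vF by (simp add: power2_eq_square algebra_simps)
    then have Fneg: "F < 0" by (simp add: mult_less_0_iff)
    have "\<bar>(v x)\<^sup>2 - k\<^sup>2 * (u x)\<^sup>2\<bar> \<le> e * (m * S)"
    proof -
      have "2 * \<eta> * S \<le> e * m * S" by (rule mult_right_mono) (use \<eta>(3) pos in simp_all)
      then show ?thesis using diff unfolding mult.assoc by (rule order_trans[rotated])
    qed
    also have "\<dots> \<le> e * (- (u x * v x))" using uv e by (intro mult_left_mono) auto
    finally have "\<bar>(v x)\<^sup>2 - k\<^sup>2 * (u x)\<^sup>2\<bar> \<le> e * (- (u x * v x))" .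
    moreover have "(v x)\<^sup>2 - k\<^sup>2 * (u x)\<^sup>2 = (F\<^sup>2 - k\<^sup>2) * (u x)\<^sup>2" "e * (- (u x * v x)) = e * (- F) * (u x)\<^sup>2"
      unfolding vF by (simp_all add: power2_eq_square algebra_simps)
    ultimately have "\<bar>(F\<^sup>2 - k\<^sup>2) * (u x)\<^sup>2\<bar> \<le> e * (- F) * (u x)\<^sup>2" by (simp only:)
    then have "\<bar>F\<^sup>2 - k\<^sup>2\<bar> * (u x)\<^sup>2 \<le> e * (- F) * (u x)\<^sup>2" by (simp only: abs_mult abs_power2)
    then have "\<bar>F\<^sup>2 - k\<^sup>2\<bar> \<le> e * (- F)" by (rule mult_right_le_imp_le) (use u_ne in simp)
    moreover have "\<bar>F\<^sup>2 - k\<^sup>2\<bar> = \<bar>F + k\<bar> * (k - F)"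
    proof -
      have "F\<^sup>2 - k\<^sup>2 = - ((F + k) * (k - F))" by (simp add: power2_eq_square algebra_simps)
      then show ?thesis using Fneg k by (simp add: abs_mult)
    qed
    moreover have "e * (- F) \<le> e * (k - F)" by (rule mult_left_mono) (use e k in simp_all)
    ultimately have "\<bar>F + k\<bar> * (k - F) \<le> e * (k - F)" by linarith
    then have "\<bar>F + k\<bar> \<le> e" by (rule mult_right_le_imp_le) (use Fneg k in simp)
    then show "u x \<noteq> 0 \<and> \<bar>v x / u x + k\<bar> \<le> e" using u_ne by (simp add: F_def)
  qed
qed

lemma u_nonzero: "\<forall>\<^sub>F x in at_top. u x \<noteq> 0"
  using ratio_eventually[OF zero_less_one] unfolding eventually_at_top_linorder by metis

lemma ratio_lim: "((\<lambda>x. v x / u x) \<longlongrightarrow> - k) at_top"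
proof (rule tendstoI)
  fix e :: real assume "0 < e"
  then have "0 < e/2" by simp
  from ratio_eventually[OF this] obtain X where X: "\<And>x. X \<le> x \<Longrightarrow> u x \<noteq> 0 \<and> \<bar>v x / u x + k\<bar> \<le> e/2" by blast
  show "\<forall>\<^sub>F x in at_top. dist (v x / u x) (- k) < e"
    using eventually_ge_at_top[of X]
  proof eventually_elim
    case (elim x)
    then show ?case using X[OF elim] \<open>0 < e\<close> by (simp add: dist_real_def)
  qed
qed

text \<open>IU - U is the tail G of u^2, so \<open>R\<close> is 1/G, and \<open>q\<close> is minus
  the derivative of log G.\<close>

definition "R = (\<lambda>x. inverse (IU - U x))"
definition "q = (\<lambda>x. (u x)\<^sup>2 * R x)"

text \<open>De l'Hospital in integrated form: the derivative - 2 (v/u) u^2 of - u^2 lies between 2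
  (k - e/4) u^2 and 2 (k + e/4) u^2 for large arguments, and integration over [x, \<infinity>)
  compares u^2 with its tail.\<close>

lemma q_lim: "(q \<longlongrightarrow> 2 * k) at_top"
proof (rule tendstoI)
  fix e :: real assume "0 < e"
  then have e4: "0 < e/4" by simp
  from ratio_eventually[OF this] obtain X
    where X: "0 \<le> X" "\<And>x. X \<le> x \<Longrightarrow> u x \<noteq> 0 \<and> \<bar>v x / u x + k\<bar> \<le> e/4" by blast
  show "\<forall>\<^sub>F x in at_top. dist (q x) (2 * k) < e"
    using eventually_ge_at_top[of X]
  proof eventually_elim
    case (elim x)
    have x: "0 \<le> x" using X(1) elim by simp
    have G: "0 < IU - U x" using U_less[OF x] by simp
    define r where "r = (\<lambda>t. v t / u t)"
    have uv: "2 * u t * v t = 2 * (r t) * (u t)\<^sup>2" and F: "\<bar>r t + k\<bar> \<le> e/4" if "x \<le> t" for t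
      using X(2)[of t] elim that by (auto simp: power2_eq_square r_def)
    have "2 * (k - e/4) * IU - 2 * (k - e/4) * U x \<le> - 0 - - (u x)\<^sup>2"
    proof (rule ac_deriv_le_lim[OF ac_deriv_cmult[OF ac_deriv_U] ac_deriv_minus[OF du2] _ tendsto_minus[OF u2_lim] x])
      show "((\<lambda>x. 2 * (k - e/4) * U x) \<longlongrightarrow> 2 * (k - e/4) * IU) at_top" by (intro tendsto_intros U_lim)
      fix t assume t: "x \<le> t"
      have "2 * (k - e/4) \<le> - (2 * (r t))" using abs_le_D1[OF F[OF t]] by (simp add: field_simps)
      then have "2 * (k - e/4) * (u t)\<^sup>2 \<le> - (2 * (r t)) * (u t)\<^sup>2" by (rule mult_right_mono) simp
      then show "2 * (k - e/4) * (u t)\<^sup>2 \<le> - (2 * u t * v t)" unfolding uv[OF t] by simp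
    qed
    moreover have "- 0 - - (u x)\<^sup>2 \<le> 2 * (k + e/4) * IU - 2 * (k + e/4) * U x"
    proof (rule ac_deriv_le_lim[OF ac_deriv_minus[OF du2] ac_deriv_cmult[OF ac_deriv_U] tendsto_minus[OF u2_lim] _ x])
      show "((\<lambda>x. 2 * (k + e/4) * U x) \<longlongrightarrow> 2 * (k + e/4) * IU) at_top" by (intro tendsto_intros U_lim)
      fix t assume t: "x \<le> t"
      have "- (2 * (r t)) \<le> 2 * (k + e/4)" using abs_le_D2[OF F[OF t]] by (simp add: field_simps)
      then have "- (2 * (r t)) * (u t)\<^sup>2 \<le> 2 * (k + e/4) * (u t)\<^sup>2" by (rule mult_right_mono) simp
      then show "- (2 * u t * v t) \<le> 2 * (k + e/4) * (u t)\<^sup>2" unfolding uv[OF t] by simp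
    qed
    ultimately have "2 * (k - e/4) * (IU - U x) \<le> (u x)\<^sup>2" "(u x)\<^sup>2 \<le> 2 * (k + e/4) * (IU - U x)"
      unfolding right_diff_distrib by linarith+
    then have "2 * (k - e/4) \<le> q x" "q x \<le> 2 * (k + e/4)"
      using G by (simp_all add: q_def R_def field_simps)
    then have "2 * k - e/2 \<le> q x" "q x \<le> 2 * k + e/2" by (simp_all add: algebra_simps)
    then have "\<bar>q x - 2 * k\<bar> \<le> e/2" by (intro abs_leI) simp_all
    then show ?case using \<open>0 < e\<close> unfolding dist_real_def by linarith
  qed
qed

end

definition potential :: "(real \<Rightarrow> real) \<Rightarrow> real \<Rightarrow> bool" where
  "potential V I \<longleftrightarrow> (\<forall>b. V absolutely_integrable_on {0..b}) \<and> sq_lim V I"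

text \<open>The normalisation u 0 = 1 makes \<open>s\<close> the Robin parameter and 1/c the
  quotient |\<phi>(0)|^2 / |\<phi>|^2, the increment of \<sigma>.\<close>

definition eigensol :: "(real \<Rightarrow> real) \<Rightarrow> real \<Rightarrow> real \<Rightarrow> real \<Rightarrow> (real \<Rightarrow> real) \<Rightarrow> (real \<Rightarrow> real) \<Rightarrow> bool" where
  "eigensol V l s c u v \<longleftrightarrow>
     ac_deriv u v \<and> ac_deriv v (\<lambda>x. (V x - l) * u x) \<and> u 0 = 1 \<and> v 0 = s \<and> sq_lim u c"

lemma eigensol_ground:
  assumes "potential V I" "eigensol V l s c u v" "l < 0"
  shows "ground V u v (sqrt (- l)) I c"
  using assms unfolding potential_def eigensol_def by unfold_locales auto

section \<open>Removal of one eigenvalue: transformed potential and transformed solutions\<close>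

context ground
begin

lemma ac_deriv_R: "ac_deriv R (\<lambda>x. (u x)\<^sup>2 * (R x)\<^sup>2)"
proof (rule ac_deriv_C1)
  fix x :: real assume x: "0 \<le> x"
  have "(U has_real_derivative (u x)\<^sup>2) (at x within {0..})"
    by (rule ac_deriv_has_real_derivative[OF ac_deriv_U _ x]) (intro continuous_intros ac_deriv_continuous_on[OF u])
  then show "(R has_real_derivative (u x)\<^sup>2 * (R x)\<^sup>2) (at x within {0..})"
    unfolding R_def using U_less[OF x] by (auto intro!: derivative_eq_intros simp: power2_eq_square)
next
  fix b
  have "\<forall>x\<in>{0..b}. IU - U x \<noteq> 0" using U_less by force
  then have "continuous_on {0..b} R"
    unfolding R_def by (intro continuous_intros ac_deriv_continuous_on[OF ac_deriv_U])
  then show "continuous_on {0..b} (\<lambda>x. (u x)\<^sup>2 * (R x)\<^sup>2)"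
    by (intro continuous_intros ac_deriv_continuous_on[OF u])
qed

text \<open>The derivative of \<open>q\<close>, by R' = u^2 R^2. As q = - (log G)', the new
  potential \<open>V1\<close> is V - 2 (log G)''.\<close>

definition "q' = (\<lambda>x. 2 * u x * v x * R x + u x ^ 4 * (R x)\<^sup>2)"
definition "V1 = (\<lambda>x. V x + 2 * q' x)"
text \<open>With \<open>F = v / u\<close> and \<open>q = u\<^sup>2 R\<close> this is \<open>4 (k\<^sup>2 q + F\<^sup>3 / 3 - (F + q)\<^sup>3 / 3)\<close>, which arises from the two
  single commutations; written without \<open>F\<close> it is meaningful at the zeros of \<open>u\<close>.\<close>

definition "B = (\<lambda>x. 4 * k\<^sup>2 * ((u x)\<^sup>2 * R x) - 4 * ((v x)\<^sup>2 * R x) - 4 * (v x * (u x ^ 3 * (R x)\<^sup>2))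
    - 4/3 * (u x ^ 6 * R x ^ 3))"

lemma R_0: "R 0 = 1 / IU"
  by (simp add: R_def U_0 inverse_eq_divide)

lemma continuous_q': "continuous_on {0..b} q'"
  unfolding q'_def by (intro continuous_intros ac_deriv_continuous_on[OF u] ac_deriv_continuous_on[OF v] ac_deriv_continuous_on[OF ac_deriv_R])

lemma V1_absint: "V1 absolutely_integrable_on {0..b}"
  unfolding V1_def
  by (intro set_integral_add(1) V_absint absolutely_integrable_continuous_real continuous_intros continuous_q')

lemma V1_sq_absint: "(\<lambda>x. (V1 x)\<^sup>2) absolutely_integrable_on {0..b}"
proof -
  have "(\<lambda>x. (V x)\<^sup>2) absolutely_integrable_on {0..b}" using V_sq_lim by (simp add: sq_lim_def)
  moreover have "(\<lambda>x. (4 * q' x) * V x) absolutely_integrable_on {0..b}"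
    by (rule absint_continuous_mult[OF _ V_absint]) (intro continuous_intros continuous_q')
  moreover have "(\<lambda>x. 4 * (q' x)\<^sup>2) absolutely_integrable_on {0..b}"
    by (intro absolutely_integrable_continuous_real continuous_intros continuous_q')
  ultimately have "(\<lambda>x. (V x)\<^sup>2 + ((4 * q' x) * V x + 4 * (q' x)\<^sup>2)) absolutely_integrable_on {0..b}"
    by (intro set_integral_add(1))
  moreover have "(\<lambda>x. (V x)\<^sup>2 + ((4 * q' x) * V x + 4 * (q' x)\<^sup>2)) = (\<lambda>x. (V1 x)\<^sup>2)"
    by (auto simp: V1_def power2_eq_square algebra_simps)
  ultimately show ?thesis by simp
qed

text \<open>Away from the zeros of \<open>u\<close>, F = v/u solves the Riccati equation F' = V +
  k^2 - F^2, and q' = 2 F q + q^2 = (F + q)^2 - F^2. Differentiating 4 (k^2 q + F^3/3 - (F + q)^3/3)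
  gives 4 q' (k^2 - F' - (F + q)^2) = - 4 q' (V + q'), which is V^2 - V1^2. In terms of u, v and R
  the same identity is polynomial.\<close>

lemma ac_deriv_B: "ac_deriv B (\<lambda>x. (V x)\<^sup>2 - (V1 x)\<^sup>2)"
proof -
  have p3: "ac_deriv (\<lambda>x. f x ^ 3) (\<lambda>x. 3 * (f x)\<^sup>2 * g x)" if "ac_deriv f g" for f g
    using ac_deriv_power[OF that, of 2] by (simp add: eval_nat_numeral)
  have p6: "ac_deriv (\<lambda>x. f x ^ 6) (\<lambda>x. 6 * f x ^ 5 * g x)" if "ac_deriv f g" for f g
    using ac_deriv_power[OF that, of 5] by (simp add: eval_nat_numeral)
  note D = ac_deriv_subtract[OF ac_deriv_subtract[OF ac_deriv_subtract[OF
        ac_deriv_cmult[OF ac_deriv_mult[OF du2 ac_deriv_R], of "4 * k\<^sup>2"]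
        ac_deriv_cmult[OF ac_deriv_mult[OF ac_deriv_power2[OF v] ac_deriv_R], of 4]]
        ac_deriv_cmult[OF ac_deriv_mult[OF v ac_deriv_mult[OF p3[OF u] ac_deriv_power2[OF ac_deriv_R]]], of 4]]
        ac_deriv_cmult[OF ac_deriv_mult[OF p6[OF u] p3[OF ac_deriv_R]], of "4/3"]]
  show ?thesis
    by (rule ac_deriv_cong[OF D])
       (simp_all add: B_def V1_def q'_def field_simps eval_nat_numeral)
qed

lemma B_0: "B 0 = 4 * k\<^sup>2 / IU - 4/3 * ((v 0 + 1 / IU) ^ 3 - v 0 ^ 3)"
  unfolding B_def R_0 u_0 by (simp add: power2_eq_square power3_eq_cube algebra_simps add_divide_distrib)

lemma B_lim: "(B \<longlongrightarrow> 16/3 * k ^ 3) at_top"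
proof -
  define F where "F = (\<lambda>x. v x / u x)"
  \<comment> \<open>F + q tends to k, so the limit is 4 (2 k^3 - k^3/3 - k^3/3).\<close>
  have "((\<lambda>x. 4 * q x * (k\<^sup>2 - (F x)\<^sup>2 - F x * q x - (q x)\<^sup>2 / 3)) \<longlongrightarrow>
      4 * (2*k) * (k\<^sup>2 - (-k)\<^sup>2 - (-k) * (2*k) - (2*k)\<^sup>2 / 3)) at_top"
    unfolding F_def by (intro tendsto_intros q_lim ratio_lim) auto
  also have "4 * (2*k) * (k\<^sup>2 - (-k)\<^sup>2 - (-k) * (2*k) - (2*k)\<^sup>2 / 3) = 16/3 * k ^ 3"
    by (simp add: power2_eq_square power3_eq_cube field_simps)
  finally show ?thesis
  proof (rule Lim_transform_eventually)
    show "\<forall>\<^sub>F x in at_top. 4 * q x * (k\<^sup>2 - (F x)\<^sup>2 - F x * q x - (q x)\<^sup>2 / 3) = B x"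
      using u_nonzero
    proof eventually_elim
      case (elim x)
      have "v x = F x * u x" using elim by (simp add: F_def)
      then show ?case by (simp add: B_def q_def field_simps eval_nat_numeral)
    qed
  qed
qed

text \<open>Square integrability of \<open>V1\<close> is read off from the identity: the integral of
  V1^2 over [0, x] is Q x - (B x - B 0), and both \<open>Q\<close> and \<open>B\<close>
  converge.\<close>

lemma potential_V1:
  "potential V1 (IV - 16/3 * k ^ 3 + (4 * k\<^sup>2 / IU - 4/3 * ((v 0 + 1 / IU) ^ 3 - v 0 ^ 3)))"
proof -
  have Q1: "integral {0..x} (\<lambda>t. (V1 t)\<^sup>2) = Q x - (B x - B 0)" if "0 \<le> x" for x
  proof -
    define Q1 where "Q1 = (\<lambda>x. integral {0..x} (\<lambda>t. (V1 t)\<^sup>2))"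
    have "ac_deriv Q1 (\<lambda>t. (V1 t)\<^sup>2)" unfolding Q1_def by (rule ac_deriv_integral[OF V1_sq_absint])
    then have "ac_deriv (\<lambda>x. Q1 x - (Q x - B x)) (\<lambda>x. 0)"
      by (rule ac_deriv_cong[OF ac_deriv_subtract[OF _ ac_deriv_subtract[OF ac_deriv_Q ac_deriv_B]]]) auto
    from ac_deriv_const_eq[OF this that] show ?thesis by (simp add: Q1_def Q_0)
  qed
  have lim: "((\<lambda>x. Q x - (B x - B 0)) \<longlongrightarrow> IV - (16/3 * k ^ 3 - B 0)) at_top"
    by (intro tendsto_intros Q_lim B_lim)
  have "((\<lambda>x. integral {0..x} (\<lambda>t. (V1 t)\<^sup>2)) \<longlongrightarrow> IV - (16/3 * k ^ 3 - B 0)) at_top"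
    by (rule Lim_transform_eventually[OF lim])
       (use eventually_ge_at_top[of "0::real"] in \<open>eventually_elim, simp add: Q1\<close>)
  also have "IV - (16/3 * k ^ 3 - B 0) = IV - 16/3 * k ^ 3 + (4 * k\<^sup>2 / IU - 4/3 * ((v 0 + 1 / IU) ^ 3 - v 0 ^ 3))"
    by (simp add: B_0)
  finally show ?thesis
    unfolding potential_def sq_lim_def using V1_absint V1_sq_absint by blast
qed

text \<open>Everything rests on the Wronskian identity for h = int_0^x u w. It yields the new
  equation, and it expresses \<open>h\<close> through boundary terms, for which l and -k^2 must
  differ. The norm is kept because the change of the squared solution is the derivative of h^2 R,
  which vanishes at 0 and at infinity.\<close>

lemma eigensol_transform:
  assumes w: "eigensol V l s c w z" and l: "l < 0" "l \<noteq> - k\<^sup>2" and s: "v 0 = s"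
  shows "\<exists>w' z'. eigensol V1 l (s + 1 / IU) c w' z'"
proof -
  have dw: "ac_deriv w z" and dz: "ac_deriv z (\<lambda>x. (V x - l) * w x)" and w0: "w 0 = 1" "z 0 = s" and w2: "sq_lim w c"
    using w by (auto simp: eigensol_def)
  interpret W: ground V w z "sqrt (- l)" IV c
    by (rule eigensol_ground[OF _ w l(1)]) (use V_absint V_sq_lim in \<open>simp add: potential_def\<close>)
  define h where "h = (\<lambda>x. integral {0..x} (\<lambda>t. u t * w t))"
  have h: "ac_deriv h (\<lambda>t. u t * w t)"
    unfolding h_def
    by (intro ac_deriv_integral absolutely_integrable_continuous_real continuous_intros
        ac_deriv_continuous_on[OF u] ac_deriv_continuous_on[OF dw])
  have h0: "h 0 = 0" by (simp add: h_def)
  have wronskian: "(l + k\<^sup>2) * h x = v x * w x - u x * z x" if "0 \<le> x" for x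
  proof -
    have "ac_deriv (\<lambda>x. u x * z x - v x * w x + (l + k\<^sup>2) * h x) (\<lambda>x. 0)"
      by (rule ac_deriv_cong[OF ac_deriv_add[OF ac_deriv_subtract[OF ac_deriv_mult[OF u dz] ac_deriv_mult[OF v dw]] ac_deriv_cmult[OF h, of "l + k\<^sup>2"]]])
         (simp_all add: algebra_simps)
    from ac_deriv_const_eq[OF this that] show ?thesis by (simp add: u_0 w0 s h0)
  qed
  define w' where "w' = (\<lambda>x. w x + u x * (h x * R x))"
  define z' where "z' = (\<lambda>x. z x + v x * (h x * R x) + (u x)\<^sup>2 * (w x * R x) + u x ^ 3 * (h x * (R x)\<^sup>2))"
  have dw': "ac_deriv w' z'"
    by (rule ac_deriv_cong[OF ac_deriv_add[OF dw ac_deriv_mult[OF u ac_deriv_mult[OF h ac_deriv_R]]]])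
       (simp_all add: w'_def z'_def field_simps eval_nat_numeral)
  have p3: "ac_deriv (\<lambda>x. f x ^ 3) (\<lambda>x. 3 * (f x)\<^sup>2 * g x)" if "ac_deriv f g" for f g
    using ac_deriv_power[OF that, of 2] by (simp add: eval_nat_numeral)
  have dz': "ac_deriv z' (\<lambda>x. (V1 x - l) * w' x)"
  proof (rule ac_deriv_cong[OF ac_deriv_add[OF ac_deriv_add[OF ac_deriv_add[OF dz
          ac_deriv_mult[OF v ac_deriv_mult[OF h ac_deriv_R]]] ac_deriv_mult[OF du2 ac_deriv_mult[OF dw ac_deriv_R]]]
          ac_deriv_mult[OF p3[OF u] ac_deriv_mult[OF h ac_deriv_power2[OF ac_deriv_R]]]]])
    fix x :: real assume x: "0 \<le> x"
    \<comment> \<open>Up to sign, this multiple of the Wronskian identity is the difference of the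
      two sides of the new equation.\<close>
    have "u x * R x * ((l + k\<^sup>2) * h x + u x * z x - v x * w x) = 0" using wronskian[OF x] by simp
    then show "(V1 x - l) * w' x = (V x - l) * w x
        + ((V x + k\<^sup>2) * u x * (h x * R x) + v x * (u x * w x * R x + h x * ((u x)\<^sup>2 * (R x)\<^sup>2)))
        + (2 * u x * v x * (w x * R x) + (u x)\<^sup>2 * (z x * R x + w x * ((u x)\<^sup>2 * (R x)\<^sup>2)))
        + (3 * (u x)\<^sup>2 * v x * (h x * (R x)\<^sup>2) + u x ^ 3 * (u x * w x * (R x)\<^sup>2 + h x * (2 * R x * ((u x)\<^sup>2 * (R x)\<^sup>2))))"
      unfolding V1_def q'_def w'_def by algebra
  qed (simp add: z'_def)
  have dP: "ac_deriv (\<lambda>x. (h x)\<^sup>2 * R x) (\<lambda>x. (w' x)\<^sup>2 - (w x)\<^sup>2)"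
    by (rule ac_deriv_cong[OF ac_deriv_mult[OF ac_deriv_power2[OF h] ac_deriv_R]])
       (simp_all add: w'_def field_simps eval_nat_numeral)
  have w'2: "(\<lambda>x. (w' x)\<^sup>2) absolutely_integrable_on {0..b}" for b
    by (intro absolutely_integrable_continuous_real continuous_intros ac_deriv_continuous_on[OF dw'])
  have eq: "integral {0..x} (\<lambda>t. (w' t)\<^sup>2) = W.U x + (h x)\<^sup>2 * R x" if "0 \<le> x" for x
  proof -
    define P where "P = (\<lambda>x. integral {0..x} (\<lambda>t. (w' t)\<^sup>2))"
    have "ac_deriv P (\<lambda>t. (w' t)\<^sup>2)" unfolding P_def by (rule ac_deriv_integral[OF w'2])
    then have "ac_deriv (\<lambda>x. P x - (W.U x + (h x)\<^sup>2 * R x)) (\<lambda>x. 0)"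
      by (rule ac_deriv_cong[OF ac_deriv_subtract[OF _ ac_deriv_add[OF W.ac_deriv_U dP]]]) auto
    from ac_deriv_const_eq[OF this that] show ?thesis by (simp add: P_def W.U_0 h0)
  qed
  \<comment> \<open>By the Wronskian identity h = u (F w - z) / (l + k^2) with F = v/u. The factor
    u^2 combines with \<open>R\<close>, which grows, to \<open>q\<close>, which converges, while w
    and z decay.\<close>
  have "((\<lambda>x. (v x / u x * w x - z x)\<^sup>2 * q x / (l + k\<^sup>2)\<^sup>2) \<longlongrightarrow> ((-k) * 0 - 0)\<^sup>2 * (2 * k) / (l + k\<^sup>2)\<^sup>2) at_top"
    using l(2) by (intro tendsto_intros ratio_lim W.u_lim W.v_lim q_lim) auto
  then have "((\<lambda>x. (v x / u x * w x - z x)\<^sup>2 * q x / (l + k\<^sup>2)\<^sup>2) \<longlongrightarrow> 0) at_top" by simp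
  then have hR: "((\<lambda>x. (h x)\<^sup>2 * R x) \<longlongrightarrow> 0) at_top"
  proof (rule Lim_transform_eventually)
    show "\<forall>\<^sub>F x in at_top. (v x / u x * w x - z x)\<^sup>2 * q x / (l + k\<^sup>2)\<^sup>2 = (h x)\<^sup>2 * R x"
      using u_nonzero eventually_ge_at_top[of "0::real"]
    proof eventually_elim
      case (elim x)
      have ne: "l + k\<^sup>2 \<noteq> 0" using l(2) by auto
      have "h x = (v x * w x - u x * z x) / (l + k\<^sup>2)"
        using wronskian[OF elim(2)] ne by (simp add: field_simps)
      also have "\<dots> = u x * (v x / u x * w x - z x) / (l + k\<^sup>2)" using elim(1) by (simp add: algebra_simps)
      finally show ?case by (simp add: q_def power_mult_distrib power_divide)
    qed
  qed
  have "((\<lambda>x. W.U x + (h x)\<^sup>2 * R x) \<longlongrightarrow> c + 0) at_top"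
    by (intro tendsto_intros W.U_lim hR)
  then have "((\<lambda>x. integral {0..x} (\<lambda>t. (w' t)\<^sup>2)) \<longlongrightarrow> c + 0) at_top"
    by (rule Lim_transform_eventually)
       (use eventually_ge_at_top[of "0::real"] in \<open>eventually_elim, simp add: eq\<close>)
  then have "sq_lim w' c" unfolding sq_lim_def using w'2 by simp
  moreover have "w' 0 = 1" "z' 0 = s + 1 / IU" by (simp_all add: w'_def z'_def h0 w0 u_0 R_0)
  ultimately show ?thesis unfolding eigensol_def using dw' dz' by blast
qed

end

text \<open>Each step removes \<open>l 0\<close>, replaces the potential and shifts all sequences by
  one, hence the induction over arbitrary V, I, l, S and c. The other solutions keep their
  \<open>c\<close>, so increments computed for the original potential remain the right ones;
  distinct eigenvalues are what the transformation requires. The integral left at the end is dropped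
  as nonnegative.\<close>

theorem finite_lieb_thirring:
  assumes "potential V I" "\<And>i. i < n \<Longrightarrow> l i < 0" "inj_on l {..<n}"
    "\<And>i. i < n \<Longrightarrow> \<exists>u v. eigensol V (l i) (S 0) (c i) u v"
    "\<And>i. i < n \<Longrightarrow> S (Suc i) = S i + 1 / c i"
  shows "(\<Sum>i<n. sqrt (- l i) ^ 3) + 1/4 * (\<Sum>i<n. S (Suc i) ^ 3 - S i ^ 3)
    \<le> 3/16 * I + 3/4 * (\<Sum>i<n. - l i * (S (Suc i) - S i))"
  using assms
proof (induction n arbitrary: V I l S c)
  case 0
  have "0 \<le> I"
  proof (rule tendsto_lowerbound)
    show "((\<lambda>x. integral {0..x} (\<lambda>t. (V t)\<^sup>2)) \<longlongrightarrow> I) at_top" using 0 by (simp add: potential_def sq_lim_def)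
    show "\<forall>\<^sub>F x in at_top. 0 \<le> integral {0..x} (\<lambda>t. (V t)\<^sup>2)"
      by (intro always_eventually allI integral_nonneg)
         (use 0 in \<open>auto simp: potential_def sq_lim_def absolutely_integrable_on_def\<close>)
  qed simp
  then show ?case by simp
next
  case (Suc n)
  obtain u v where uv: "eigensol V (l 0) (S 0) (c 0) u v" using Suc.prems(4)[of 0] by auto
  define k where "k = sqrt (- l 0)"
  have l0: "l 0 < 0" using Suc.prems(2) by simp
  interpret ground V u v k I "c 0"
    unfolding k_def by (rule eigensol_ground[OF Suc.prems(1) uv l0])
  have k2: "k\<^sup>2 = - l 0" using l0 by (simp add: k_def)
  have v0: "v 0 = S 0" using uv by (simp add: eigensol_def)
  have S1: "S (Suc 0) = S 0 + 1 / c 0" using Suc.prems(5)[of 0] by simp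
  define I1 where "I1 = I - 16/3 * k ^ 3 + (4 * k\<^sup>2 / c 0 - 4/3 * ((S 0 + 1 / c 0) ^ 3 - S 0 ^ 3))"
  have "(\<Sum>i<n. sqrt (- l (Suc i)) ^ 3) + 1/4 * (\<Sum>i<n. S (Suc (Suc i)) ^ 3 - S (Suc i) ^ 3)
    \<le> 3/16 * I1 + 3/4 * (\<Sum>i<n. - l (Suc i) * (S (Suc (Suc i)) - S (Suc i)))"
  proof (rule Suc.IH[where c = "\<lambda>i. c (Suc i)"])
    show "potential V1 I1" using potential_V1 unfolding I1_def v0 .
    show "inj_on (\<lambda>i. l (Suc i)) {..<n}" using Suc.prems(3) by (auto simp: inj_on_def)
    show "\<exists>u v. eigensol V1 (l (Suc i)) (S (Suc 0)) (c (Suc i)) u v" if i: "i < n" for i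
    proof -
      obtain w z where wz: "eigensol V (l (Suc i)) (S 0) (c (Suc i)) w z" using Suc.prems(4)[of "Suc i"] i by auto
      have "l (Suc i) \<noteq> l 0" using inj_onD[OF Suc.prems(3), of "Suc i" 0] i by auto
      then show ?thesis unfolding S1 by (intro eigensol_transform[OF wz]) (use Suc.prems(2) i k2 v0 in auto)
    qed
  qed (use Suc.prems in auto)
  moreover have "3/16 * I1 = 3/16 * I - k ^ 3 + (3/4 * (k\<^sup>2 / c 0) - 1/4 * (S (Suc 0) ^ 3 - S 0 ^ 3))"
    by (simp add: I1_def S1 algebra_simps)
  moreover have "k\<^sup>2 / c 0 = - l 0 * (S (Suc 0) - S 0)" by (simp add: k2 S1)
  ultimately show ?case
    by (simp add: sum.lessThan_Suc_shift k_def[symmetric] algebra_simps del: sum.lessThan_Suc)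
qed

section \<open>Robin eigenfunctions\<close>

lemma absint_halfline:
  fixes f :: "real \<Rightarrow> real"
  assumes f: "f absolutely_integrable_on {0<..}"
  shows "f absolutely_integrable_on {0..b}"
    and "((\<lambda>x. integral {0..x} f) \<longlongrightarrow> (LINT x:{0<..}|lebesgue. f x)) at_top"
proof -
  have neg: "negligible {x \<in> {0..} - {0<..}. f x \<noteq> 0}" "negligible {x \<in> {0<..} - {0..}. f x \<noteq> 0}"
    by (rule negligible_subset[of "{0}"]; force)+
  have f0: "f absolutely_integrable_on {0..}"
    using absolutely_integrable_spike_set_eq[OF neg] f by blast
  then show b: "f absolutely_integrable_on {0..b}" for b by (rule absolutely_integrable_on_subinterval) auto
  have "((\<lambda>b. LINT x:{0..b}|lebesgue. f x) \<longlongrightarrow> (LINT x:{0..}|lebesgue. f x)) at_top"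
    by (rule tendsto_set_lebesgue_integral_at_top) (use f0 in auto)
  moreover have "(LINT x:{0..b}|lebesgue. f x) = integral {0..b} f" for b
    by (rule set_lebesgue_integral_eq_integral(2)[OF b])
  moreover have "(LINT x:{0..}|lebesgue. f x) = (LINT x:{0<..}|lebesgue. f x)"
    unfolding set_lebesgue_integral_eq_integral(2)[OF f0] set_lebesgue_integral_eq_integral(2)[OF f]
    by (rule integral_spike_set[OF neg])
  ultimately show "((\<lambda>x. integral {0..x} f) \<longlongrightarrow> (LINT x:{0<..}|lebesgue. f x)) at_top" by simp
qed

lemma potential_halfline:
  fixes V :: "real \<Rightarrow> real"
  assumes "V absolutely_integrable_on {0<..}" "V \<in> L2_halfline"
  shows "potential V (LINT x:{0<..}|lebesgue. (V x)\<^sup>2)"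
  using absint_halfline[OF assms(1)] absint_halfline[of "\<lambda>x. (V x)\<^sup>2"] assms(2)
  unfolding potential_def sq_lim_def L2_halfline_def by simp

lemma AE_halfline_negligible:
  fixes P :: "real \<Rightarrow> bool"
  assumes "AE x in lebesgue_on {0<..}. P x"
  obtains N where "negligible N" "\<And>x. 0 < x \<Longrightarrow> x \<notin> N \<Longrightarrow> P x"
proof -
  have "AE x in lebesgue. 0 < x \<longrightarrow> P x"
    using assms by (subst (asm) AE_restrict_space_iff) auto
  then obtain N where "negligible N" "{x. \<not> (0 < x \<longrightarrow> P x)} \<subseteq> N"
    unfolding eventually_ae_filter_negligible by blast
  then show ?thesis using that by blast
qed

lemma ac_deriv_AE_cong:
  assumes f: "ac_deriv f g" and N: "negligible N" "\<And>x. 0 < x \<Longrightarrow> x \<notin> N \<Longrightarrow> h x = g x"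
  shows "ac_deriv f h"
proof (rule ac_derivI)
  have N0: "negligible (insert 0 N)" using N(1) by simp
  show "h absolutely_integrable_on {0..b}" for b
    by (rule absolutely_integrable_spike[OF ac_deriv_absint[OF f order_refl] N0]) (use N(2) in auto)
  fix x :: real assume x: "0 \<le> x"
  have "integral {0..x} h = integral {0..x} g" by (rule integral_spike[OF N0]) (use N(2) in auto)
  then show "f x = f 0 + integral {0..x} h" using ac_deriv_eq[OF f x] by simp
qed

text \<open>The real and imaginary parts of \<phi>' have densities, which are almost everywhere
  their pointwise derivatives and so, by the eigenvalue equation, almost everywhere (V - \<mu>)
  times the parts of \<phi>. The factor \<omega> gives access to every real component, in particular
  those of \<phi> and of \<phi>/\<phi>(0).\<close>

lemma eigenfunction_ode:
  assumes ef: "robin_eigenfunction V \<sigma>\<^sub>0 \<mu> \<phi>"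
  shows "ac_deriv (\<lambda>x. Re (\<omega> * \<phi> x)) (\<lambda>x. Re (\<omega> * hderiv \<phi> x))"
    and "ac_deriv (\<lambda>x. Re (\<omega> * hderiv \<phi> x)) (\<lambda>x. (V x - \<mu>) * Re (\<omega> * \<phi> x))"
proof -
  define p where "p = hderiv \<phi>"
  have dphi: "(\<phi> has_vector_derivative p x) (at x within {0..})" if "0 \<le> x" for x
    using ef that vector_derivative_works unfolding robin_eigenfunction_def robin_domain_def p_def hderiv_def by blast
  have lac: "locally_abs_cont p"
    using ef unfolding robin_eigenfunction_def robin_domain_def p_def by blast
  obtain g1 where g1: "ac_deriv (\<lambda>x. Re (p x)) g1"
    using locally_abs_cont_imp_ac_deriv[OF locally_abs_cont_Re_Im(1)[OF lac]] by blast
  obtain g2 where g2: "ac_deriv (\<lambda>x. Im (p x)) g2"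
    using locally_abs_cont_imp_ac_deriv[OF locally_abs_cont_Re_Im(2)[OF lac]] by blast
  obtain N1 where N1: "negligible N1"
    "\<And>x. 0 < x \<Longrightarrow> x \<notin> N1 \<Longrightarrow> ((\<lambda>x. Re (p x)) has_real_derivative g1 x) (at x within {0..})"
    using ac_deriv_AE_derivative[OF g1] by blast
  obtain N2 where N2: "negligible N2"
    "\<And>x. 0 < x \<Longrightarrow> x \<notin> N2 \<Longrightarrow> ((\<lambda>x. Im (p x)) has_real_derivative g2 x) (at x within {0..})"
    using ac_deriv_AE_derivative[OF g2] by blast
  have "AE x in lebesgue_on {0<..}. schroedinger V \<phi> x = of_real \<mu> * \<phi> x"
    using ef unfolding robin_eigenfunction_def by blast
  then obtain N3 where N3: "negligible N3"
    "\<And>x. 0 < x \<Longrightarrow> x \<notin> N3 \<Longrightarrow> schroedinger V \<phi> x = of_real \<mu> * \<phi> x"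
    using AE_halfline_negligible by blast
  have key: "(V x - \<mu>) * Re (\<phi> x) = g1 x" "(V x - \<mu>) * Im (\<phi> x) = g2 x"
    if x: "0 < x" "x \<notin> N1 \<union> N2 \<union> N3" for x
  proof -
    have "(p has_vector_derivative Complex (g1 x) (g2 x)) (at x within {0..})"
      using N1(2)[of x] N2(2)[of x] x
      unfolding has_vector_derivative_complex_iff has_real_derivative_iff_has_vector_derivative by simp
    moreover have "at x within {0..} \<noteq> bot"
      using x(1) at_within_open_subset[of x "{0<..}" "{0..}"] by (simp add: subset_eq)
    ultimately have "hderiv p x = Complex (g1 x) (g2 x)"
      unfolding hderiv_def by (intro vector_derivative_within)
    moreover have "- hderiv p x + of_real (V x) * \<phi> x = of_real \<mu> * \<phi> x"
      using N3(2)[of x] x unfolding schroedinger_def p_def by simp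
    ultimately have "of_real (V x - \<mu>) * \<phi> x = Complex (g1 x) (g2 x)"
      by (simp add: algebra_simps add_eq_0_iff)
    then show "(V x - \<mu>) * Re (\<phi> x) = g1 x" "(V x - \<mu>) * Im (\<phi> x) = g2 x"
      by (auto simp: complex_eq_iff)
  qed
  have neg: "negligible (N1 \<union> N2 \<union> N3)" using N1(1) N2(1) N3(1) by (intro negligible_Un)
  have r: "ac_deriv (\<lambda>x. Re (p x)) (\<lambda>x. (V x - \<mu>) * Re (\<phi> x))"
    by (rule ac_deriv_AE_cong[OF g1 neg key(1)])
  have i: "ac_deriv (\<lambda>x. Im (p x)) (\<lambda>x. (V x - \<mu>) * Im (\<phi> x))"
    by (rule ac_deriv_AE_cong[OF g2 neg key(2)])
  have r0: "ac_deriv (\<lambda>x. Re (\<phi> x)) (\<lambda>x. Re (p x))" and i0: "ac_deriv (\<lambda>x. Im (\<phi> x)) (\<lambda>x. Im (p x))"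
    using dphi ac_deriv_continuous_on[OF r] ac_deriv_continuous_on[OF i]
    unfolding has_vector_derivative_complex_iff has_real_derivative_iff_has_vector_derivative[symmetric]
    by (auto intro: ac_deriv_C1)
  show "ac_deriv (\<lambda>x. Re (\<omega> * \<phi> x)) (\<lambda>x. Re (\<omega> * hderiv \<phi> x))"
    by (rule ac_deriv_cong[OF ac_deriv_subtract[OF ac_deriv_cmult[OF r0, of "Re \<omega>"] ac_deriv_cmult[OF i0, of "Im \<omega>"]]])
       (auto simp: p_def)
  show "ac_deriv (\<lambda>x. Re (\<omega> * hderiv \<phi> x)) (\<lambda>x. (V x - \<mu>) * Re (\<omega> * \<phi> x))"
    by (rule ac_deriv_cong[OF ac_deriv_subtract[OF ac_deriv_cmult[OF r, of "Re \<omega>"] ac_deriv_cmult[OF i, of "Im \<omega>"]]])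
       (auto simp: p_def algebra_simps)
qed

text \<open>Uniqueness for the real equation is used twice: \<phi>(0) = 0 would force \<phi> = 0,
  and \<phi>/\<phi>(0) is real because its imaginary part has zero data at 0, the parameter
  \<open_sigma> being real.\<close>

lemma eigenfunction_eigensol:
  assumes V: "\<And>b. V absolutely_integrable_on {0..b}" and ef: "robin_eigenfunction V \<sigma>\<^sub>0 \<mu> \<phi>"
  shows "\<exists>c u v. eigensol V \<mu> \<sigma>\<^sub>0 c u v \<and> (cmod (\<phi> 0))\<^sup>2 / (L2_norm \<phi>)\<^sup>2 = 1 / c"
proof -
  note ode = eigenfunction_ode[OF ef]
  have W: "(\<lambda>x. V x - \<mu>) absolutely_integrable_on {0..b}" for b
    by (intro set_integral_diff(1) V) auto
  have p0: "hderiv \<phi> 0 = of_real \<sigma>\<^sub>0 * \<phi> 0" and L2: "\<phi> \<in> L2_halfline"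
    using ef unfolding robin_eigenfunction_def robin_domain_def by blast+
  have Re0: "Re (\<omega> * \<phi> x) = 0" if "Re (\<omega> * \<phi> 0) = 0" "0 \<le> x" for \<omega> x
  proof -
    have "Re (\<omega> * hderiv \<phi> 0) = \<sigma>\<^sub>0 * Re (\<omega> * \<phi> 0)" unfolding p0 by (simp add: algebra_simps)
    then show ?thesis
      using ac_deriv_ode_unique[OF ode(1)[of \<omega>] ode(2)[of \<omega>] W order_refl that(1) _ that(2)] that(1) by simp
  qed
  define z where "z = \<phi> 0"
  have z: "z \<noteq> 0"
  proof
    assume "z = 0"
    then have "\<phi> x = 0" if "0 < x" for x
      \<comment> \<open>The factors 1 and - \<i> select the real and the imaginary part.\<close>
      using Re0[of 1 x] Re0[of "- \<i>" x] that by (simp add: z_def complex_eq_iff)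
    then have "AE x in lebesgue_on {0<..}. \<phi> x = 0" by (intro AE_I2) auto
    then show False using ef unfolding robin_eigenfunction_def by blast
  qed
  define u where "u = (\<lambda>x. Re (1 / z * \<phi> x))"
  define v where "v = (\<lambda>x. Re (1 / z * hderiv \<phi> x))"
  have phi: "\<phi> x = z * of_real (u x)" if "0 \<le> x" for x
  proof -
    have "Re (- \<i> / z * \<phi> x) = 0" by (rule Re0[OF _ that]) (use z in \<open>simp add: z_def\<close>)
    then have "Im (1 / z * \<phi> x) = 0" by (simp add: divide_inverse mult.assoc)
    then have "1 / z * \<phi> x = of_real (u x)" by (simp add: u_def complex_eq_iff)
    then show ?thesis using z by (simp add: field_simps)
  qed
  define D where "D = (LINT x:{0<..}|lebesgue. (norm (\<phi> x))\<^sup>2)"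
  have phi2: "(\<lambda>x. (norm (\<phi> x))\<^sup>2) absolutely_integrable_on {0<..}" using L2 unfolding L2_halfline_def by blast
  have "0 \<le> D" unfolding D_def set_lebesgue_integral_eq_integral(2)[OF phi2]
    by (rule integral_nonneg) (use phi2 in \<open>auto simp: absolutely_integrable_on_def\<close>)
  then have norm: "(L2_norm \<phi>)\<^sup>2 = D" unfolding L2_norm_def D_def by simp
  define c where "c = D / (cmod z)\<^sup>2"
  have u2: "(u x)\<^sup>2 = (norm (\<phi> x))\<^sup>2 / (cmod z)\<^sup>2" if "0 \<le> x" for x
    using z unfolding phi[OF that] by (simp add: norm_mult power_mult_distrib)
  have "sq_lim u c"
    unfolding sq_lim_def
  proof (intro conjI allI)
    show "(\<lambda>x. (u x)\<^sup>2) absolutely_integrable_on {0..b}" for b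
      unfolding u_def
      by (intro absolutely_integrable_continuous_real continuous_on_power ac_deriv_continuous_on[OF ode(1)])
    have "((\<lambda>x. integral {0..x} (\<lambda>x. (norm (\<phi> x))\<^sup>2) / (cmod z)\<^sup>2) \<longlongrightarrow> c) at_top"
      unfolding c_def D_def by (intro tendsto_intros absint_halfline(2) phi2) (use z in auto)
    moreover have "integral {0..x} (\<lambda>t. (u t)\<^sup>2) = integral {0..x} (\<lambda>x. (norm (\<phi> x))\<^sup>2) / (cmod z)\<^sup>2" for x
    proof -
      have "integral {0..x} (\<lambda>t. (u t)\<^sup>2) = integral {0..x} (\<lambda>x. (norm (\<phi> x))\<^sup>2 / (cmod z)\<^sup>2)"
        by (rule integral_cong) (use u2 in auto)
      then show ?thesis by simp
    qed
    ultimately show "((\<lambda>x. integral {0..x} (\<lambda>t. (u t)\<^sup>2)) \<longlongrightarrow> c) at_top" by simp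
  qed
  moreover have "u 0 = 1" using z by (simp add: u_def z_def)
  moreover have "v 0 = \<sigma>\<^sub>0" using z by (simp add: v_def p0 z_def)
  ultimately have "eigensol V \<mu> \<sigma>\<^sub>0 c u v"
    unfolding eigensol_def using ode[of "1 / z"] unfolding u_def v_def by blast
  moreover have "(cmod (\<phi> 0))\<^sup>2 / (L2_norm \<phi>)\<^sup>2 = 1 / c" by (simp add: norm c_def z_def)
  ultimately show ?thesis by blast
qed

section \<open>Passage to sums with values in [0, \<infinity>]\<close>

lemma infsum_ennreal_SUP_initial:
  fixes f :: "nat \<Rightarrow> ennreal"
  shows "infsum f J = (SUP n. sum f (J \<inter> {..n}))"
proof (rule antisym)
  show "infsum f J \<le> (SUP n. sum f (J \<inter> {..n}))"
    unfolding nonneg_infsum_complete[OF zero_le]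
  proof (rule SUP_least)
    fix F assume "F \<in> {F. finite F \<and> F \<subseteq> J}"
    then have F: "finite F" "F \<subseteq> J" by auto
    then obtain n where "F \<subseteq> {..n}" by (meson finite_nat_iff_bounded_le)
    then have "sum f F \<le> sum f (J \<inter> {..n})" using F by (intro sum_mono2) auto
    also have "\<dots> \<le> (SUP n. sum f (J \<inter> {..n}))" by (rule SUP_upper) simp
    finally show "sum f F \<le> (SUP n. sum f (J \<inter> {..n}))" .
  qed
  show "(SUP n. sum f (J \<inter> {..n})) \<le> infsum f J"
    unfolding nonneg_infsum_complete[OF zero_le] by (intro SUP_least SUP_upper) auto
qed

lemma ennreal_affine:
  "0 \<le> x \<Longrightarrow> 0 \<le> r \<Longrightarrow> 0 \<le> y \<Longrightarrow> ennreal (x + r * y) = ennreal x + ennreal r * ennreal y"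
  by (simp add: ennreal_mult)

lemma powr_three_halves: "0 \<le> x \<Longrightarrow> x powr (3/2) = sqrt x ^ 3"
proof -
  assume x: "0 \<le> x"
  show ?thesis
  proof (cases "x = 0")
    case False
    then have "sqrt x ^ 3 = (x powr (1/2)) powr (real 3)"
      using x by (simp add: powr_half_sqrt powr_realpow)
    also have "\<dots> = x powr (3/2)" by (simp add: powr_powr)
    finally show ?thesis by simp
  qed simp
qed

theorem theorem1p1:
  fixes V :: "real \<Rightarrow> real" and \<sigma>\<^sub>0 :: real
    and N :: enat and J :: "nat set"
    and lam :: "nat \<Rightarrow> real" and \<phi> :: "nat \<Rightarrow> real \<Rightarrow> complex" and \<sigma> :: "nat \<Rightarrow> real"
  assumes V_L1: "V absolutely_integrable_on {0<..}"
    and V_L2: "V \<in> L2_halfline"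
    and J: "J = {j. 1 \<le> j \<and> enat j \<le> N}"
    and lam_increasing: "strict_mono_on J lam"
    and lam_enumerates: "lam ` J = negative_eigenvalues V \<sigma>\<^sub>0"
    and eigenfunctions: "\<And>j. j \<in> J \<Longrightarrow> robin_eigenfunction V \<sigma>\<^sub>0 (lam j) (\<phi> j)"
    and sigma_0: "\<sigma> 0 = \<sigma>\<^sub>0"
    and sigma_rec: "\<And>j. j \<in> J \<Longrightarrow>
          \<sigma> j = \<sigma> (j - 1) + (cmod (\<phi> j 0))\<^sup>2 / (L2_norm (\<phi> j))\<^sup>2"
  shows "(\<Sum>\<^sub>\<infinity>j\<in>J. ennreal (\<bar>lam j\<bar> powr (3/2)))
           + ennreal (1/4) * (\<Sum>\<^sub>\<infinity>j\<in>J. ennreal ((\<sigma> j) ^ 3 - (\<sigma> (j - 1)) ^ 3))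
         \<le> ennreal (3/16 * (LINT x:{0<..}|lebesgue. (V x)\<^sup>2))
           + ennreal (3/4) * (\<Sum>\<^sub>\<infinity>j\<in>J. ennreal (\<bar>lam j\<bar> * (\<sigma> j - \<sigma> (j - 1))))"
proof -
  define I where "I = (LINT x:{0<..}|lebesgue. (V x)\<^sup>2)"
  have pot: "potential V I" unfolding I_def by (rule potential_halfline[OF V_L1 V_L2])
  have lam_neg: "lam j < 0" if "j \<in> J" for j
    using lam_enumerates that unfolding negative_eigenvalues_def by blast
  have mono: "\<sigma> (j - 1) \<le> \<sigma> j" if "j \<in> J" for j using sigma_rec[OF that] by simp
  have "\<forall>j\<in>J. \<exists>c. (\<exists>u v. eigensol V (lam j) \<sigma>\<^sub>0 c u v) \<and> (cmod (\<phi> j 0))\<^sup>2 / (L2_norm (\<phi> j))\<^sup>2 = 1 / c"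
    using eigenfunction_eigensol[OF _ eigenfunctions] pot unfolding potential_def by blast
  then obtain c where c: "\<And>j. j \<in> J \<Longrightarrow> \<exists>u v. eigensol V (lam j) \<sigma>\<^sub>0 (c j) u v"
    "\<And>j. j \<in> J \<Longrightarrow> (cmod (\<phi> j 0))\<^sup>2 / (L2_norm (\<phi> j))\<^sup>2 = 1 / c j"
    by metis
  define a where "a = (\<lambda>j. \<bar>lam j\<bar> powr (3/2))"
  define b where "b = (\<lambda>j. \<sigma> j ^ 3 - \<sigma> (j - 1) ^ 3)"
  define d where "d = (\<lambda>j. \<bar>lam j\<bar> * (\<sigma> j - \<sigma> (j - 1)))"
  have nn: "0 \<le> a j" "0 \<le> b j" "0 \<le> d j" if "j \<in> J" for j
    using mono[OF that] by (auto simp: a_def b_def d_def power_mono_odd)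
  \<comment> \<open>An initial segment of \<open>J\<close> is {1..m}, and the finite inequality is
    applied with i = j - 1, so that \<sigma> i is the parameter before the j-th removal.\<close>
  have fin: "sum a (J \<inter> {..n}) + 1/4 * sum b (J \<inter> {..n}) \<le> 3/16 * I + 3/4 * sum d (J \<inter> {..n})" for n
  proof -
    obtain m where m: "J \<inter> {..n} = {Suc 0..m}"
    proof (cases N)
      case (enat k)
      then have "J \<inter> {..n} = {Suc 0..min n k}" by (auto simp: J)
      then show ?thesis by (rule that)
    next
      case infinity
      then have "J \<inter> {..n} = {Suc 0..n}" by (auto simp: J)
      then show ?thesis by (rule that)
    qed
    have mJ: "Suc i \<in> J" if "i < m" for i
    proof -
      have "Suc i \<in> {Suc 0..m}" using that by simp
      then show ?thesis using m by blast
    qed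
    have "(\<Sum>i<m. sqrt (- lam (Suc i)) ^ 3) + 1/4 * (\<Sum>i<m. \<sigma> (Suc i) ^ 3 - \<sigma> i ^ 3)
      \<le> 3/16 * I + 3/4 * (\<Sum>i<m. - lam (Suc i) * (\<sigma> (Suc i) - \<sigma> i))"
    proof (rule finite_lieb_thirring[OF pot, where c = "\<lambda>i. c (Suc i)"])
      show "inj_on (\<lambda>i. lam (Suc i)) {..<m}"
        using strict_mono_on_imp_inj_on[OF lam_increasing] mJ unfolding inj_on_def by blast
    qed (use lam_neg c sigma_rec sigma_0 mJ in auto)
    moreover have "(\<Sum>i<m. sqrt (- lam (Suc i)) ^ 3) = sum a (J \<inter> {..n})"
      unfolding m sum.atLeast1_atMost_eq a_def
    proof (rule sum.cong)
      fix i assume "i \<in> {..<m}"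
      then show "sqrt (- lam (Suc i)) ^ 3 = \<bar>lam (Suc i)\<bar> powr (3/2)"
        using lam_neg[OF mJ[of i]] powr_three_halves[of "- lam (Suc i)"] by simp
    qed simp
    moreover have "(\<Sum>i<m. \<sigma> (Suc i) ^ 3 - \<sigma> i ^ 3) = sum b (J \<inter> {..n})"
      unfolding m sum.atLeast1_atMost_eq b_def by simp
    moreover have "(\<Sum>i<m. - lam (Suc i) * (\<sigma> (Suc i) - \<sigma> i)) = sum d (J \<inter> {..n})"
      unfolding m sum.atLeast1_atMost_eq d_def
      using lam_neg[OF mJ] by (intro sum.cong) (auto simp: abs_of_neg)
    ultimately show ?thesis by simp
  qed
  have en: "sum (\<lambda>j. ennreal (f j)) (J \<inter> {..n}) = ennreal (sum f (J \<inter> {..n}))" if "\<And>j. j \<in> J \<Longrightarrow> 0 \<le> f j" for f n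
    using that by (intro sum_ennreal) auto
  have inc: "incseq (\<lambda>n. sum f (J \<inter> {..n}))" for f :: "nat \<Rightarrow> ennreal"
    unfolding incseq_def by (auto intro!: sum_mono2)
  \<comment> \<open>The finite inequality without eigenvalues; the sign allows the right-hand side
    to be split into extended reals.\<close>
  have "0 \<le> I"
    using finite_lieb_thirring[OF pot, of 0 lam \<sigma> c] by simp
  have step: "ennreal (sum a (J \<inter> {..n})) + ennreal (1/4) * ennreal (sum b (J \<inter> {..n}))
      \<le> ennreal (3/16 * I) + ennreal (3/4) * (\<Sum>\<^sub>\<infinity>j\<in>J. ennreal (d j))" for n
  proof -
    have s: "0 \<le> sum a (J \<inter> {..n})" "0 \<le> sum b (J \<inter> {..n})" "0 \<le> sum d (J \<inter> {..n})"
      using nn by (auto intro!: sum_nonneg)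
    have "ennreal (sum a (J \<inter> {..n})) + ennreal (1/4) * ennreal (sum b (J \<inter> {..n}))
        = ennreal (sum a (J \<inter> {..n}) + 1/4 * sum b (J \<inter> {..n}))"
      by (rule ennreal_affine[symmetric]) (use s in auto)
    also have "\<dots> \<le> ennreal (3/16 * I + 3/4 * sum d (J \<inter> {..n}))" by (rule ennreal_leI[OF fin])
    also have "\<dots> = ennreal (3/16 * I) + ennreal (3/4) * ennreal (sum d (J \<inter> {..n}))"
      by (rule ennreal_affine) (use s \<open>0 \<le> I\<close> in auto)
    also have "ennreal (sum d (J \<inter> {..n})) \<le> (\<Sum>\<^sub>\<infinity>j\<in>J. ennreal (d j))"
    proof -
      have "ennreal (sum d (J \<inter> {..n})) = sum (\<lambda>j. ennreal (d j)) (J \<inter> {..n})"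
        using en[of d n] nn(3) by simp
      also have "\<dots> \<le> (\<Sum>\<^sub>\<infinity>j\<in>J. ennreal (d j))"
        unfolding infsum_ennreal_SUP_initial by (rule SUP_upper) simp
      finally show ?thesis .
    qed
    finally show ?thesis by (simp add: add_left_mono mult_left_mono)
  qed
  \<comment> \<open>Both partial sums on the left increase with n, so the sum of the suprema is a
    supremum of sums. The right-hand side of \<open>step\<close> already contains the full
    series.\<close>
  have "(\<Sum>\<^sub>\<infinity>j\<in>J. ennreal (a j)) + ennreal (1/4) * (\<Sum>\<^sub>\<infinity>j\<in>J. ennreal (b j))
      = (SUP n. sum (\<lambda>j. ennreal (a j)) (J \<inter> {..n}) + ennreal (1/4) * sum (\<lambda>j. ennreal (b j)) (J \<inter> {..n}))"
    unfolding infsum_ennreal_SUP_initial SUP_mult_left_ennreal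
    by (rule ennreal_SUP_add[symmetric]) (use inc in \<open>auto simp: incseq_def intro!: mult_left_mono\<close>)
  also have "\<dots> \<le> ennreal (3/16 * I) + ennreal (3/4) * (\<Sum>\<^sub>\<infinity>j\<in>J. ennreal (d j))"
    by (rule SUP_least) (use step en[of a] en[of b] nn(1,2) in simp)
  finally show ?thesis unfolding a_def b_def d_def I_def .
qed

end
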